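(* Let $d\ge2$, $N\ge2$ be integers and let $p_c(N,d)\le p<1$. There is a constant $D<1$ (which may depend on $N,d,p$), independent of $\epsilon$, such that for every $\epsilon>0$, almost surely, if $\mathcal C^c\neq\emptyset$ then $$\mathbb E_p\big[\underline{\dim}_B(\mathcal C^{c,\epsilon})\big]\le D\,\dim_B(\mathcal C^c),$$ where $\mathcal C^{c,\epsilon}$ is the union of the connected components of $\mathcal C$ of diameter at least $\epsilon$, and $\mathcal C$ is the limiting set of fractal percolation in $[0,1]^d$ with parameters $N,p$.
   Context: Fractal percolation. For integers $d\ge2$, $N\ge 2$, a level-$n$ cube ($n\ge1$) is a cube $D^n_{\mathbf k}=\prod_{j=1}^d\left[\frac{k_j-1}{N^n},\frac{k_j}{N^n}\right]$ with $\mathbf k=(k_1,\dots,k_d)\in\{1,\dots,N^n\}^d$. Let $\Omega$ be the set of $\{0,1\}$-valued functions $\omega$ on the set of all cubes of all levels $n\ge1$, and let $\mathbb P_p$ be the product measure on $\Omega$ under which $\omega(D^n_{\mathbf k})=1$ with probability $p\in[0,1]$, independently for all cubes; $\mathbb E_p$ is the corresponding expectation. Let $\mathcal C^n\subset[0,1]^d$ be the union of all level-$n$ cubes $Q$ such that $\omega=1$ for $Q$ and for each of the cubes of levels $1,\dots,n-1$ containing $Q$; the limiting set is $\mathcal C=\bigcap_{n\ge1}\mathcal C^n$. For $x\in\mathcal C$ let $\mathcal C_x$ be the connected component of $x$ in $\mathcal C$; $\mathcal C^c=\{x\in\mathcal C:\mathcal C_x\ne\{x\}\}$. Critical value: $p_c(N,d)=\sup\{p:\mathcal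 C\text{ is }\mathbb P_p\text{-a.s. totally disconnected}\}$. For a bounded set $F\subset\mathbb R^d$, $M_\delta(F)$ is the minimal number of closed cubes of side length $\delta$ needed to cover $F$; $\underline{\dim}_B(F)=\liminf_{\delta\to0}\frac{\log M_\delta(F)}{-\log\delta}$, $\overline{\dim}_B(F)=\limsup_{\delta\to0}\frac{\log M_\delta(F)}{-\log\delta}$, and if they coincide the common value is $\dim_B(F)$. For $p_c(N,d)\le p<1$, $\dim_B(\mathcal C^c)$ exists almost surely. All dimensions of the empty set are taken to be $0$. *)

theory Defs
  imports "HOL-Probability.Probability"
begin

section \<open>Box-counting dimension\<close>

definition axis_cube :: "real ^ 'd \<Rightarrow> real \<Rightarrow> (real ^ 'd) set" where
  "axis_cube a \<delta> = cbox a (\<chi> j. a $ j + \<delta>)"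

text \<open>A covering number is only meaningful for bounded sets; all sets below lie in the unit cube.\<close>

definition covering_number :: "real \<Rightarrow> (real ^ 'd) set \<Rightarrow> nat" where
  "covering_number \<delta> F =
     (LEAST m. \<exists>A. finite A \<and> card A = m \<and> F \<subseteq> (\<Union>a\<in>A. axis_cube a \<delta>))"

definition lower_box_dim :: "(real ^ 'd) set \<Rightarrow> ereal" where
  "lower_box_dim F =
     (if F = {} then 0
      else Liminf (at_right 0) (\<lambda>\<delta>. ereal (ln (real (covering_number \<delta> F)) / - ln \<delta>)))"

definition upper_box_dim :: "(real ^ 'd) set \<Rightarrow> ereal" where
  "upper_box_dim F =
     (if F = {} then 0
      else Limsup (at_right 0) (\<lambda>\<delta>. ereal (ln (real (covering_number \<delta> F)) / - ln \<delta>)))"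

text \<open>Unspecified when the lower and upper dimensions differ.\<close>

definition box_dim :: "(real ^ 'd) set \<Rightarrow> ereal" where
  "box_dim F = (THE s. lower_box_dim F = s \<and> upper_box_dim F = s)"


section \<open>Components\<close>

definition totally_disconnected :: "'a::topological_space set \<Rightarrow> bool" where
  "totally_disconnected S \<longleftrightarrow> (\<forall>x\<in>S. connected_component_set S x = {x})"

definition nontrivial_part :: "'a::topological_space set \<Rightarrow> 'a set" where
  "nontrivial_part S = {x \<in> S. connected_component_set S x \<noteq> {x}}"

definition large_part :: "real \<Rightarrow> 'a::metric_space set \<Rightarrow> 'a set" where
  "large_part \<epsilon> S = \<Union>{K \<in> components S. diameter K \<ge> \<epsilon>}"


section \<open>Fractal percolation in the unit cube\<close>

definition grid_cube :: "nat \<Rightarrow> nat \<Rightarrow> ('d \<Rightarrow> nat) \<Rightarrow> (real ^ 'd) set" where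
  "grid_cube N n k =
     cbox (\<chi> j. (real (k j) - 1) / real N ^ n) (\<chi> j. real (k j) / real N ^ n)"

definition level_cubes :: "nat \<Rightarrow> nat \<Rightarrow> (real ^ 'd) set set" where
  "level_cubes N n = {grid_cube N n k | k. \<forall>j. k j \<in> {1..N ^ n}}"

definition all_cubes :: "nat \<Rightarrow> (real ^ 'd) set set" where
  "all_cubes N = (\<Union>n\<in>{1..}. level_cubes N n)"

text \<open>
  The value \<open>True\<close> plays the role of \<open>1\<close>. Since \<open>bernoulli_pmf\<close> clamps its argument, this is the
  intended measure only for \<open>p\<close> in the unit interval.
\<close>

definition percolation :: "nat \<Rightarrow> real \<Rightarrow> ((real ^ 'd) set \<Rightarrow> bool) measure" where
  "percolation N p = (\<Pi>\<^sub>M Q\<in>all_cubes N. measure_pmf (bernoulli_pmf p))"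

definition retained_cubes :: "nat \<Rightarrow> ((real ^ 'd) set \<Rightarrow> bool) \<Rightarrow> nat \<Rightarrow> (real ^ 'd) set set" where
  "retained_cubes N \<omega> n =
     {Q \<in> level_cubes N n. \<omega> Q \<and> (\<forall>m\<in>{1..<n}. \<forall>R\<in>level_cubes N m. Q \<subseteq> R \<longrightarrow> \<omega> R)}"

definition limit_set :: "nat \<Rightarrow> ((real ^ 'd) set \<Rightarrow> bool) \<Rightarrow> (real ^ 'd) set" where
  "limit_set N \<omega> = (\<Inter>n\<in>{1..}. \<Union>(retained_cubes N \<omega> n))"

text \<open>The dimension enters as the cardinality of the index type.\<close>

definition critical_prob :: "'d::finite itself \<Rightarrow> nat \<Rightarrow> real" where
  "critical_prob _ N =
     Sup {p. 0 \<le> p \<and> p \<le> 1 \<and>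
       (AE \<omega> in (percolation N p :: ((real ^ 'd) set \<Rightarrow> bool) measure).
          totally_disconnected (limit_set N \<omega>))}"

text \<open>
  The expectation of a nonnegative extended-real variable. The Lebesgue integral for nonnegative
  functions is used so that no default value can arise from a failure of integrability;
  box dimensions of subsets of the unit cube are nonnegative, so nothing is truncated.
\<close>

definition expect_nonneg :: "'a measure \<Rightarrow> ('a \<Rightarrow> ereal) \<Rightarrow> ereal" where
  "expect_nonneg M X = enn2ereal (\<integral>\<^sup>+ \<omega>. e2ennreal (X \<omega>) \<partial>M)"

end

theory Submission
  imports Defs
begin

text \<open>
  Write \<open>d\<close> for the dimension and let \<open>m = p N^d\<close> be the mean number of retained children of a cube.

  If a level-\<open>n\<close> cube \<open>Q\<close> meets a component of diameter at least \<open>\<epsilon>\<close>, then at every level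
  \<open>j \<le> n\<close> with \<open>N^(-j)\<close> small compared to \<open>\<epsilon>\<close> the ancestor of \<open>Q\<close> has an open neighbour, since
  otherwise the component would be trapped in it. Different levels are independent, so each costs a
  factor \<open>c < 1\<close> that depends on \<open>p\<close> and \<open>d\<close> only, and the expected number of such cubes is
  \<open>O((m c)^n)\<close>. By Borel--Cantelli the dimension of the large components is almost surely at most
  \<open>log (max 1 (m c)) / log N\<close>; for \<open>m \<le> 1\<close> there are almost surely no large components.

  If the nontrivial part is not almost surely empty, then \<open>m > 1\<close> and the number of level-\<open>n\<close> cubes
  whose own subtree contains a nontrivial component almost surely grows like \<open>m^n\<close> unless the process
  dies out: a second-moment estimate gives this growth with positive probability, and it occurs as
  soon as it occurs below one retained cube. So the nontrivial part has box dimension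
  \<open>log m / log N\<close> almost surely when it is nonempty, and \<open>D = log (max 1 (m c)) / log m\<close> works.
\<close>

section \<open>Independence in infinite product spaces\<close>

text \<open>Two obstacles shape the lower bound. That the limit set has a nontrivial component is
  not visibly an event. It is replaced by the events that every finite approximation joins two
  points at distance at least \<open>inverse (real (Suc i))\<close>: each level tests finitely many
  cubes, and compactness leads back to the limit set. Moreover, whether a cube is marked depends on
  its whole subtree, so the counts are not adapted to the generations and martingale convergence
  does not apply directly. But their increments are centred and obey the same first-generation
  recursion, so the second moment of the increment at level \<open>n\<close> is of order
  \<open>mean ^ n\<close>, small against the squared normalisation. The step from positive to full
  probability compares survival with growth: they satisfy opposite inequalities for the generating
  function of the number of children, which by convexity has at most one fixed point below 1. For
  the upper bound, neighbours are only asked to be open, not retained, so that each level involves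
  its own cubes alone. Both dimensions are in the end compared with constants, so the expectation
  costs nothing.\<close>

definition depends_on :: "(('i \<Rightarrow> 'a) \<Rightarrow> 'b) \<Rightarrow> 'i set \<Rightarrow> bool" where
  "depends_on f K \<longleftrightarrow> (\<forall>\<omega> \<omega>'. (\<forall>i\<in>K. \<omega> i = \<omega>' i) \<longrightarrow> f \<omega> = f \<omega>')"

lemma depends_onI: "(\<And>\<omega> \<omega>'. (\<And>i. i \<in> K \<Longrightarrow> \<omega> i = \<omega>' i) \<Longrightarrow> f \<omega> = f \<omega>') \<Longrightarrow> depends_on f K"
  unfolding depends_on_def by blast

lemma depends_onD: "depends_on f K \<Longrightarrow> (\<And>i. i \<in> K \<Longrightarrow> \<omega> i = \<omega>' i) \<Longrightarrow> f \<omega> = f \<omega>'"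
  unfolding depends_on_def by blast

text \<open>The joint law of the coordinates is the law of the identity on the product space, and
  that is the product of the marginals.\<close>

lemma indep_vars_coordinates:
  assumes M: "\<And>i. i \<in> I \<Longrightarrow> prob_space (M i)" and "I \<noteq> {}"
  shows "prob_space.indep_vars (PiM I M) M (\<lambda>i \<omega>. \<omega> i) I"
proof -
  interpret prob_space "PiM I M" using M by (rule prob_space_PiM)
  have "distr (PiM I M) (PiM I M) (\<lambda>x. restrict x I) = PiM I M"
    by (subst distr_cong[where g = "\<lambda>x. x" and L = "PiM I M"])
       (auto simp: space_PiM)
  moreover have "PiM I (\<lambda>i. distr (PiM I M) (M i) (\<lambda>\<omega>. \<omega> i)) = PiM I M"
    by (intro PiM_cong) (auto intro!: distr_PiM_component M)
  ultimately show ?thesis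
    by (subst indep_vars_iff_distr_eq_PiM') (auto simp: assms)
qed

text \<open>Freezing the coordinates outside \<open>K l\<close> at a fixed point \<open>d\<close>
  writes \<open>f l\<close> as a measurable function of the tuple restricted to \<open>K l\<close>,
  and restrictions to disjoint index sets are independent. So \<open>depends_on\<close> together
  with measurability on the whole product stands in for measurability with respect to the
  coordinates in \<open>K l\<close>.\<close>

lemma indep_vars_depends_on:
  assumes M: "\<And>i. i \<in> I \<Longrightarrow> prob_space (M i)" and I: "I \<noteq> {}"
    and f: "\<And>l. l \<in> L \<Longrightarrow> f l \<in> measurable (PiM I M) (N l)"
    and dep: "\<And>l. l \<in> L \<Longrightarrow> depends_on (f l) (K l)"
    and K: "\<And>l. l \<in> L \<Longrightarrow> K l \<subseteq> I" and disj: "disjoint_family_on K L"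
  shows "prob_space.indep_vars (PiM I M) N f L"
proof -
  interpret prob_space "PiM I M" using M by (rule prob_space_PiM)
  obtain d where d: "d \<in> space (PiM I M)" using not_empty by blast
  define ext where "ext = (\<lambda>l \<eta>. \<lambda>i\<in>I. if i \<in> K l then \<eta> i else d i)"
  have ext: "ext l \<in> measurable (PiM (K l) M) (PiM I M)" for l
    unfolding ext_def
  proof (rule measurable_restrict)
    fix i assume "i \<in> I"
    then show "(\<lambda>\<eta>. if i \<in> K l then \<eta> i else d i) \<in> measurable (PiM (K l) M) (M i)"
      using d by (cases "i \<in> K l") (auto simp: space_PiM PiE_iff)
  qed
  have "indep_vars (\<lambda>l. PiM (K l) M) (\<lambda>l \<omega>. restrict (\<lambda>i. \<omega> i) (K l)) L"
    by (rule indep_vars_restrict[OF indep_vars_coordinates[OF M I] K disj])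
  then have "indep_vars N (\<lambda>l \<omega>. (f l \<circ> ext l) (restrict (\<lambda>i. \<omega> i) (K l))) L"
    by (rule indep_vars_compose2) (use f ext in \<open>auto intro: measurable_comp\<close>)
  moreover have "(f l \<circ> ext l) (restrict (\<lambda>i. \<omega> i) (K l)) = f l \<omega>" if "l \<in> L" for l \<omega>
    unfolding comp_def by (rule depends_onD[OF dep[OF that]]) (use K[OF that] in \<open>auto simp: ext_def\<close>)
  ultimately show ?thesis
    by (subst indep_vars_cong[OF refl, where Y = "\<lambda>l \<omega>. (f l \<circ> ext l) (restrict (\<lambda>i. \<omega> i) (K l))" and N' = N]) auto
qed

text \<open>The event is a finite union of cylinders, one for each possible set \<open>S\<close> of
  true coordinates in \<open>J\<close>. \<open>P\<close> may therefore be any predicate, for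
  instance a topological one.\<close>

lemma sets_depends_on_finite:
  fixes P :: "('i \<Rightarrow> bool) \<Rightarrow> bool"
  assumes dep: "depends_on P J" and J: "finite J" "J \<subseteq> I"
    and M: "\<And>i. i \<in> I \<Longrightarrow> sets (M i) = UNIV"
  shows "{\<omega> \<in> space (PiM I M). P \<omega>} \<in> sets (PiM I M)"
proof -
  have "{\<omega> \<in> space (PiM I M). P \<omega>} =
      (\<Union>S\<in>{S. S \<subseteq> J \<and> P (\<lambda>i. i \<in> S)}. {\<omega> \<in> space (PiM I M). \<forall>i\<in>J. \<omega> i = (i \<in> S)})"
  proof (intro equalityI subsetI)
    fix \<omega> assume \<omega>: "\<omega> \<in> {\<omega> \<in> space (PiM I M). P \<omega>}"
    then have "P (\<lambda>i. i \<in> {i \<in> J. \<omega> i})"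
      using depends_onD[OF dep, of \<omega> "\<lambda>i. i \<in> {i \<in> J. \<omega> i}"] by auto
    then show "\<omega> \<in> (\<Union>S\<in>{S. S \<subseteq> J \<and> P (\<lambda>i. i \<in> S)}. {\<omega> \<in> space (PiM I M). \<forall>i\<in>J. \<omega> i = (i \<in> S)})"
      using \<omega> by (intro UN_I[of "{i \<in> J. \<omega> i}"]) auto
  next
    fix \<omega> assume "\<omega> \<in> (\<Union>S\<in>{S. S \<subseteq> J \<and> P (\<lambda>i. i \<in> S)}. {\<omega> \<in> space (PiM I M). \<forall>i\<in>J. \<omega> i = (i \<in> S)})"
    then obtain S where S: "P (\<lambda>i. i \<in> S)" "\<omega> \<in> space (PiM I M)" "\<forall>i\<in>J. \<omega> i = (i \<in> S)" by auto
    then show "\<omega> \<in> {\<omega> \<in> space (PiM I M). P \<omega>}"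
      using depends_onD[OF dep, of \<omega> "\<lambda>i. i \<in> S"] by auto
  qed
  also have "\<dots> \<in> sets (PiM I M)"
  proof (rule sets.finite_UN)
    show "finite {S. S \<subseteq> J \<and> P (\<lambda>i. i \<in> S)}"
      by (rule finite_subset[of _ "Pow J"]) (auto simp: J)
    fix S
    show "{\<omega> \<in> space (PiM I M). \<forall>i\<in>J. \<omega> i = (i \<in> S)} \<in> sets (PiM I M)"
    proof (rule sets.sets_Collect_finite_All[OF _ J(1)])
      fix i assume "i \<in> J"
      then have "i \<in> I" using J by auto
      have "(\<lambda>\<omega>. \<omega> i) -` {i \<in> S} \<inter> space (PiM I M) \<in> sets (PiM I M)"
        by (rule measurable_sets[OF measurable_component_singleton[OF \<open>i \<in> I\<close>]])
           (use M[OF \<open>i \<in> I\<close>] in auto)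
      then show "{\<omega> \<in> space (PiM I M). \<omega> i = (i \<in> S)} \<in> sets (PiM I M)"
        by (simp add: vimage_def Int_def conj_commute)
    qed
  qed
  finally show ?thesis .
qed

section \<open>The cubes of the grid\<close>

lemma level_cubesI: "(\<And>j. 1 \<le> k j \<and> k j \<le> N ^ n) \<Longrightarrow> grid_cube N n k \<in> level_cubes N n"
  unfolding level_cubes_def by auto

lemma level_cubesE:
  assumes "Q \<in> level_cubes N n"
  obtains k where "Q = grid_cube N n k" "\<And>j. 1 \<le> k j" "\<And>j. k j \<le> N ^ n"
  using assms unfolding level_cubes_def by fastforce

lemma mem_grid_cube:
  assumes "0 < N"
  shows "x \<in> grid_cube N n k \<longleftrightarrow>
    (\<forall>j. real (k j) - 1 \<le> x $ j * real N ^ n \<and> x $ j * real N ^ n \<le> real (k j))"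
  using assms by (simp add: grid_cube_def mem_box_cart field_simps)

lemma grid_cube_corners:
  fixes k :: "'d::finite \<Rightarrow> nat"
  assumes "0 < N"
  shows "(\<chi> j. (real (k j) - 1) / real N ^ n) \<in> grid_cube N n k"
    and "(\<chi> j. real (k j) / real N ^ n) \<in> grid_cube N n k"
  using assms by (simp_all add: mem_grid_cube)

text \<open>A cube has positive side length and so does not fit into the common face of two cubes of
  one level: ancestors are unique.\<close>

lemma grid_cube_subset_unique:
  fixes k k' l :: "'d::finite \<Rightarrow> nat"
  assumes N: "0 < N" and "grid_cube N n l \<subseteq> grid_cube N m k" "grid_cube N n l \<subseteq> grid_cube N m k'"
  shows "k = k'"
proof
  fix j
  let ?a = "(real (l j) - 1) / real N ^ n * real N ^ m" and ?b = "real (l j) / real N ^ n * real N ^ m"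
  have lt: "?a < ?b" using N by (simp add: divide_strict_right_mono)
  have "real (k j) - 1 \<le> ?a" "?b \<le> real (k j)" "real (k' j) - 1 \<le> ?a" "?b \<le> real (k' j)"
    using subsetD[OF assms(2) grid_cube_corners(1)[OF N]] subsetD[OF assms(2) grid_cube_corners(2)[OF N]]
      subsetD[OF assms(3) grid_cube_corners(1)[OF N]] subsetD[OF assms(3) grid_cube_corners(2)[OF N]] N
    by (auto simp: mem_grid_cube dest!: spec[of _ j])
  with lt have "real (k j) < real (k' j) + 1" "real (k' j) < real (k j) + 1" by linarith+
  then show "k j = k' j" by linarith
qed

text \<open>The side length determines the level. Configurations are indexed by cubes as sets, so
  this is what makes states at different levels different coordinates.\<close>

lemma grid_cube_level_unique:
  fixes k l :: "'d::finite \<Rightarrow> nat"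
  assumes N: "2 \<le> N" and eq: "grid_cube N n k = grid_cube N m l"
  shows "n = m"
proof -
  have N0: "0 < N" using N by simp
  fix j :: 'd
  let ?u = "(\<chi> j. real (k j) / real N ^ n) :: real ^ 'd" and ?v = "(\<chi> j. (real (k j) - 1) / real N ^ n) :: real ^ 'd"
  let ?u' = "(\<chi> j. real (l j) / real N ^ m) :: real ^ 'd" and ?v' = "(\<chi> j. (real (l j) - 1) / real N ^ m) :: real ^ 'd"
  have "?u \<in> grid_cube N m l" "?v \<in> grid_cube N m l" "?u' \<in> grid_cube N n k" "?v' \<in> grid_cube N n k"
    using grid_cube_corners[OF N0] eq by (metis, metis, metis, metis)
  then have a: "real (l j) - 1 \<le> (real (k j) - 1) / real N ^ n * real N ^ m"
      "real (k j) / real N ^ n * real N ^ m \<le> real (l j)"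
      "real (k j) - 1 \<le> (real (l j) - 1) / real N ^ m * real N ^ n"
      "real (l j) / real N ^ m * real N ^ n \<le> real (k j)"
    using N0 by (auto simp: mem_grid_cube)
  have "real N ^ m / real N ^ n \<le> 1"
    using a(1,2) by (simp add: diff_divide_distrib left_diff_distrib)
  moreover have "real N ^ n / real N ^ m \<le> 1"
    using a(3,4) by (simp add: diff_divide_distrib left_diff_distrib)
  ultimately have "real N ^ m = real N ^ n" using N0 by (simp add: field_simps)
  then show "n = m" using N by (simp add: power_inject_exp)
qed

lemma level_cubes_disjoint:
  assumes "2 \<le> N" "Q \<in> level_cubes N n" "Q \<in> level_cubes N m"
  shows "n = m"
  using assms grid_cube_level_unique by (metis level_cubesE)

lemma finite_level_cubes: "finite (level_cubes N n :: (real ^ 'd::finite) set set)"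
  and card_level_cubes: "card (level_cubes N n :: (real ^ 'd::finite) set set) \<le> (N ^ n) ^ CARD('d)"
proof -
  let ?K = "PiE (UNIV :: 'd set) (\<lambda>_. {1..N ^ n})"
  have sub: "level_cubes N n = grid_cube N n ` ?K"
    unfolding level_cubes_def by (fastforce simp: PiE_UNIV_domain)
  have fin: "finite ?K" by (intro finite_PiE) auto
  show "finite (level_cubes N n :: (real ^ 'd) set set)" using sub fin by simp
  have "card ?K = (N ^ n) ^ CARD('d)" by (simp add: card_PiE)
  then show "card (level_cubes N n :: (real ^ 'd::finite) set set) \<le> (N ^ n) ^ CARD('d)"
    unfolding sub using card_image_le[OF fin, of "grid_cube N n"] by metis
qed

lemma level_cubes_subset_all: "1 \<le> n \<Longrightarrow> level_cubes N n \<subseteq> all_cubes N"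
  unfolding all_cubes_def by auto

lemma level_cubes_nonempty:
  assumes "0 < N" shows "level_cubes N n \<noteq> {}"
  using level_cubesI[of "\<lambda>_. 1" N n] assms by (auto simp: Suc_le_eq)

lemma all_cubes_nonempty: "0 < N \<Longrightarrow> all_cubes N \<noteq> {}"
  using level_cubes_nonempty[of N 1] unfolding all_cubes_def by fastforce

lemma level_cube_props:
  assumes "0 < N" "Q \<in> level_cubes N n"
  shows "compact Q" "convex Q" "Q \<noteq> {}" "connected Q"
proof -
  obtain k where k: "Q = grid_cube N n k" using assms(2) by (rule level_cubesE)
  show "compact Q" "convex Q" unfolding k grid_cube_def by auto
  then show "connected Q" by (simp add: convex_connected)
  show "Q \<noteq> {}" using grid_cube_corners[OF assms(1)] k by blast
qed

lemma diameter_level_cube: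
  fixes Q :: "(real ^ 'd::finite) set"
  assumes "0 < N" "Q \<in> level_cubes N n"
  shows "diameter Q \<le> real CARD('d) / real N ^ n"
proof -
  obtain k where k: "Q = grid_cube N n k" using assms(2) by (rule level_cubesE)
  have "dist x y \<le> real CARD('d) / real N ^ n" if "x \<in> Q" "y \<in> Q" for x y
  proof -
    have "\<bar>(x - y) $ j\<bar> \<le> 1 / real N ^ n" for j
    proof -
      have "real (k j) - 1 \<le> x $ j * real N ^ n" "x $ j * real N ^ n \<le> real (k j)"
        "real (k j) - 1 \<le> y $ j * real N ^ n" "y $ j * real N ^ n \<le> real (k j)"
        using that assms k by (auto simp: mem_grid_cube)
      then have "\<bar>x $ j * real N ^ n - y $ j * real N ^ n\<bar> \<le> 1" by linarith
      then have "\<bar>(x $ j - y $ j) * real N ^ n\<bar> \<le> 1" by (simp add: left_diff_distrib)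
      then have "\<bar>(x - y) $ j\<bar> * real N ^ n \<le> 1" by (simp add: abs_mult)
      then show ?thesis using assms by (simp add: pos_le_divide_eq)
    qed
    then have "(\<Sum>j\<in>UNIV. \<bar>(x - y) $ j\<bar>) \<le> (\<Sum>j\<in>(UNIV::'d set). 1 / real N ^ n)" by (intro sum_mono)
    then show ?thesis using norm_le_l1_cart[of "x - y"] by (simp add: dist_norm)
  qed
  then show ?thesis by (intro diameter_le) (auto simp: dist_norm intro: order_trans)
qed

lemma level_cube_unit:
  assumes N: "0 < N" and Q: "Q \<in> level_cubes N n" and x: "x \<in> Q"
  shows "0 \<le> x $ j \<and> x $ j \<le> 1"
proof -
  obtain l where l: "Q = grid_cube N n l" "\<And>j. 1 \<le> l j" "\<And>j. l j \<le> N ^ n"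
    using Q by (auto elim: level_cubesE)
  have "real (l j) - 1 \<le> x $ j * real N ^ n" "x $ j * real N ^ n \<le> real (l j)"
    using x N unfolding l(1) by (auto simp: mem_grid_cube)
  moreover have "1 \<le> real (l j)" using l(2)[of j] by simp
  moreover have "real (l j) \<le> real N ^ n" using l(3)[of j] by (metis of_nat_le_iff of_nat_power)
  ultimately have "0 \<le> x $ j * real N ^ n" "x $ j * real N ^ n \<le> 1 * real N ^ n" by linarith+
  moreover have "0 < real N ^ n" using N by simp
  ultimately show ?thesis by (auto simp: zero_le_mult_iff mult_le_cancel_right)
qed

section \<open>Self-similarity of the grid\<close>

definition shrink :: "nat \<Rightarrow> ('d \<Rightarrow> nat) \<Rightarrow> real ^ 'd \<Rightarrow> real ^ 'd" where
  "shrink N k x = (\<chi> j. (x $ j + real (k j) - 1) / real N)"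

definition first_digits :: "nat \<Rightarrow> ('d \<Rightarrow> nat) set" where
  "first_digits N = {k. \<forall>j. k j \<in> {1..N}}"

lemma first_digits_eq: "first_digits N = PiE (UNIV :: 'd set) (\<lambda>_. {1..N})"
  unfolding first_digits_def by (auto simp: PiE_UNIV_domain)

lemma finite_first_digits: "finite (first_digits N :: ('d::finite \<Rightarrow> nat) set)"
  unfolding first_digits_eq by (intro finite_PiE) auto

lemma card_first_digits: "card (first_digits N :: ('d::finite \<Rightarrow> nat) set) = N ^ CARD('d)"
  unfolding first_digits_eq by (simp add: card_PiE)

lemma level_1_cubeI: "k \<in> first_digits N \<Longrightarrow> grid_cube N 1 k \<in> level_cubes N 1"
  unfolding first_digits_def by (rule level_cubesI) auto

lemma level_1_cubeE:
  assumes "Q \<in> level_cubes N 1"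
  obtains k where "k \<in> first_digits N" "Q = grid_cube N 1 k"
proof -
  obtain k where "Q = grid_cube N 1 k" "\<And>j. 1 \<le> k j" "\<And>j. k j \<le> N ^ 1"
    using assms by (rule level_cubesE) auto
  then show thesis by (intro that[of k]) (auto simp: first_digits_def)
qed

lemma inj_shrink: "0 < N \<Longrightarrow> inj (shrink N k)"
  unfolding shrink_def by (auto intro!: injI simp: vec_eq_iff)

lemma continuous_shrink: "0 < N \<Longrightarrow> continuous_on A (shrink N k)"
  unfolding shrink_def by (intro continuous_intros) auto

text \<open>\<open>shrink N k\<close> is the similarity of ratio \<open>1 / N\<close> that carries
  the unit cube onto the first-generation cube \<open>k\<close>. In units of
  \<open>1 / N ^ Suc n\<close> that cube starts at \<open>N ^ n * (k j - 1)\<close>, hence the shift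
  of the index.\<close>

lemma shrink_grid_cube:
  fixes k l :: "'d::finite \<Rightarrow> nat"
  assumes N: "0 < N" and k: "\<And>j. 1 \<le> k j"
  shows "shrink N k ` grid_cube N n l = grid_cube N (Suc n) (\<lambda>j. l j + N ^ n * (k j - 1))"
proof (intro equalityI subsetI)
  have e: "real (l j + N ^ n * (k j - 1)) = real (l j) + real N ^ n * (real (k j) - 1)" for j
    using k by (simp add: of_nat_diff)
  {
    fix y assume "y \<in> shrink N k ` grid_cube N n l"
    then obtain x where x: "x \<in> grid_cube N n l" "y = shrink N k x" by auto
    then have "y $ j * real N ^ Suc n = x $ j * real N ^ n + real N ^ n * (real (k j) - 1)" for j
      using N by (simp add: shrink_def field_simps)
    then show "y \<in> grid_cube N (Suc n) (\<lambda>j. l j + N ^ n * (k j - 1))"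
      using x(1) unfolding mem_grid_cube[OF N] e by auto
  next
    fix y assume y: "y \<in> grid_cube N (Suc n) (\<lambda>j. l j + N ^ n * (k j - 1))"
    let ?x = "(\<chi> j. y $ j * real N - (real (k j) - 1)) :: real ^ 'd"
    have 1: "shrink N k ?x = y" using N by (simp add: shrink_def vec_eq_iff)
    have 2: "y $ j * real N ^ Suc n = ?x $ j * real N ^ n + real N ^ n * (real (k j) - 1)" for j
      by (simp add: algebra_simps)
    have "?x \<in> grid_cube N n l"
      using y unfolding mem_grid_cube[OF N] e 2 by auto
    then show "y \<in> shrink N k ` grid_cube N n l" by (rule image_eqI[where x = ?x, rotated]) (rule 1[symmetric])
  }
qed

lemma shrink_level_cube:
  fixes k :: "'d::finite \<Rightarrow> nat"
  assumes N: "0 < N" and k: "k \<in> first_digits N" and Q: "Q \<in> level_cubes N n"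
  shows "shrink N k ` Q \<in> level_cubes N (Suc n)" "shrink N k ` Q \<subseteq> grid_cube N 1 k"
proof -
  obtain l where l: "Q = grid_cube N n l" "\<And>j. 1 \<le> l j" "\<And>j. l j \<le> N ^ n" using Q by (rule level_cubesE) auto
  have k1: "1 \<le> k j" "k j \<le> N" for j using k by (auto simp: first_digits_def)
  have le: "l j + N ^ n * (k j - 1) \<le> N ^ Suc n" for j
  proof -
    have "l j + N ^ n * (k j - 1) \<le> N ^ n + N ^ n * (k j - 1)" using l by simp
    also have "\<dots> = N ^ n * k j" using k1[of j] by (cases "k j") auto
    also have "\<dots> \<le> N ^ n * N" using k1[of j] by simp
    finally show ?thesis by (simp add: mult.commute)
  qed
  have ge: "1 \<le> l j + N ^ n * (k j - 1)" for j using l(2)[of j] by simp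
  show "shrink N k ` Q \<in> level_cubes N (Suc n)"
    unfolding l(1) shrink_grid_cube[OF N k1(1)] by (intro level_cubesI conjI ge le)
  show "shrink N k ` Q \<subseteq> grid_cube N 1 k"
  proof
    fix y assume "y \<in> shrink N k ` Q"
    then obtain x where x: "x \<in> Q" "y = shrink N k x" by auto
    have "0 \<le> x $ j \<and> x $ j \<le> 1" for j
      using level_cube_unit[OF N Q, of x j] x by simp
    then show "y \<in> grid_cube N 1 k" using x N by (simp add: mem_grid_cube shrink_def)
  qed
qed

lemma level_cube_Suc_shrink:
  fixes Q :: "(real ^ 'd::finite) set"
  assumes N: "0 < N" and Q: "Q \<in> level_cubes N (Suc n)"
  obtains k R where "k \<in> first_digits N" "R \<in> level_cubes N n" "Q = shrink N k ` R"
proof -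
  obtain l where l: "Q = grid_cube N (Suc n) l" "\<And>j. 1 \<le> l j" "\<And>j. l j \<le> N ^ Suc n"
    using Q by (rule level_cubesE) auto
  \<comment> \<open>Indices start at 1, so the leading base-\<open>N\<close> digit is split off from
    \<open>l j - 1\<close>, and 1 is added back to quotient and remainder.\<close>
  define k where "k = (\<lambda>j. (l j - 1) div N ^ n + 1)"
  define r where "r = (\<lambda>j. (l j - 1) mod N ^ n + 1)"
  have "(l j - 1) div N ^ n < N" for j
    using l(2,3)[of j] N by (simp add: less_mult_imp_div_less)
  then have "k \<in> first_digits N" unfolding k_def first_digits_def by (auto simp: Suc_le_eq)
  moreover have "grid_cube N n r \<in> level_cubes N n"
    unfolding r_def using N by (intro level_cubesI) (auto simp: Suc_le_eq)
  moreover have "l = (\<lambda>j. r j + N ^ n * (k j - 1))"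
  proof
    fix j
    have "r j + N ^ n * (k j - 1) = (l j - 1) mod N ^ n + N ^ n * ((l j - 1) div N ^ n) + 1"
      by (simp add: r_def k_def)
    also have "\<dots> = l j" using l(2)[of j] by simp
    finally show "l j = r j + N ^ n * (k j - 1)" ..
  qed
  then have "Q = shrink N k ` grid_cube N n r"
    unfolding l(1) by (subst shrink_grid_cube[OF N]) (auto simp: k_def)
  ultimately show thesis using that by blast
qed

lemma shrink_subset_unique:
  assumes "0 < N" and "k \<in> first_digits N" and "Q \<in> level_cubes N n"
    and "shrink N k ` Q \<subseteq> grid_cube N 1 k'"
  shows "k = k'"
proof -
  obtain l where "shrink N k ` Q = grid_cube N (Suc n) l"
    using shrink_level_cube(1)[OF assms(1-3)] by (rule level_cubesE)
  then show ?thesis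
    using grid_cube_subset_unique[OF assms(1)] shrink_level_cube(2)[OF assms(1-3)] assms(4) by metis
qed

lemma level_cube_parent:
  fixes Q :: "(real ^ 'd::finite) set"
  assumes N: "0 < N" and "Q \<in> level_cubes N (m + n)"
  shows "\<exists>R\<in>level_cubes N m. Q \<subseteq> R"
  using assms(2)
proof (induction m arbitrary: Q)
  case 0
  have "x \<in> grid_cube N 0 (\<lambda>_. 1)" if x: "x \<in> Q" for x
  proof -
    have "0 \<le> x $ j \<and> x $ j \<le> 1" for j
      using level_cube_unit[OF N _ x, of n j] 0 by simp
    then show ?thesis using N by (simp add: mem_grid_cube)
  qed
  then show ?case using level_cubesI[of "\<lambda>_. 1" N 0] by auto
next
  case (Suc m)
  then have "Q \<in> level_cubes N (Suc (m + n))" by simp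
  then obtain k R where k: "k \<in> first_digits N" "R \<in> level_cubes N (m + n)" "Q = shrink N k ` R"
    by (rule level_cube_Suc_shrink[OF N])
  then obtain S where "S \<in> level_cubes N m" "R \<subseteq> S" using Suc.IH by blast
  then show ?case using shrink_level_cube(1)[OF N k(1)] k(3) by blast
qed

lemma level_cube_ancestor:
  fixes Q :: "(real ^ 'd::finite) set"
  assumes "0 < N" "Q \<in> level_cubes N n" "m \<le> n"
  obtains R where "R \<in> level_cubes N m" "Q \<subseteq> R"
proof -
  have "Q \<in> level_cubes N (m + (n - m))" using assms by simp
  from level_cube_parent[OF assms(1) this] show thesis using that by blast
qed

section \<open>Retained cubes and the limit set\<close>

definition approx_set :: "nat \<Rightarrow> ((real ^ 'd) set \<Rightarrow> bool) \<Rightarrow> nat \<Rightarrow> (real ^ 'd) set" where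
  "approx_set N \<omega> n = \<Union>(retained_cubes N \<omega> n)"

text \<open>The configuration below the first-generation cube \<open>k\<close>, rescaled to the unit
  cube. Points of the product space take the value \<open>undefined\<close> outside
  \<open>all_cubes N\<close>; the restriction keeps the result in that space.\<close>

definition subtree :: "nat \<Rightarrow> ('d::finite \<Rightarrow> nat) \<Rightarrow> ((real ^ 'd) set \<Rightarrow> bool) \<Rightarrow> (real ^ 'd) set \<Rightarrow> bool" where
  "subtree N k \<omega> = (\<lambda>S\<in>all_cubes N. \<omega> (shrink N k ` S))"

definition children :: "nat \<Rightarrow> ((real ^ 'd) set \<Rightarrow> bool) \<Rightarrow> ('d::finite \<Rightarrow> nat) set" where
  "children N \<omega> = {k \<in> first_digits N. \<omega> (grid_cube N 1 k)}"

lemma retained_cubes_level: "retained_cubes N \<omega> n \<subseteq> level_cubes N n"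
  unfolding retained_cubes_def by auto

lemma finite_retained_cubes: "finite (retained_cubes N \<omega> n :: (real ^ 'd::finite) set set)"
  using retained_cubes_level finite_level_cubes by (rule finite_subset)

lemma retained_cubes_1: "retained_cubes N \<omega> 1 = grid_cube N 1 ` children N \<omega>"
proof (intro equalityI subsetI)
  fix Q assume Q: "Q \<in> retained_cubes N \<omega> 1"
  then have "Q \<in> level_cubes N 1" by (simp add: retained_cubes_def)
  then obtain k where "k \<in> first_digits N" "Q = grid_cube N 1 k" by (rule level_1_cubeE)
  then show "Q \<in> grid_cube N 1 ` children N \<omega>"
    using Q by (auto simp: retained_cubes_def children_def)
next
  fix Q assume "Q \<in> grid_cube N 1 ` children N \<omega>"
  then show "Q \<in> retained_cubes N \<omega> 1"
    using level_1_cubeI by (auto simp: retained_cubes_def children_def simp del: One_nat_def)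
qed

text \<open>From level 1 on, the proper ancestors of the image of \<open>R\<close> under
  \<open>shrink N k\<close> are the first-generation cube \<open>k\<close> and the images of the
  proper ancestors of \<open>R\<close>. Level 0 is excluded because the unit cube is not in
  \<open>all_cubes N\<close>, so a configuration carries no information there.\<close>

lemma retained_cubes_Suc:
  fixes \<omega> :: "(real ^ 'd::finite) set \<Rightarrow> bool"
  assumes N: "2 \<le> N" and n: "1 \<le> n"
  shows "retained_cubes N \<omega> (Suc n) =
    (\<Union>k\<in>children N \<omega>. (`) (shrink N k) ` retained_cubes N (subtree N k \<omega>) n)"
proof (intro equalityI subsetI)
  have N0: "0 < N" using N by simp
  have sub: "subtree N k \<omega> R = \<omega> (shrink N k ` R)" if "R \<in> level_cubes N m" "1 \<le> m" for k :: "'d \<Rightarrow> nat" and R m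
    using that level_cubes_subset_all unfolding subtree_def by auto
  {
    fix Q assume Q: "Q \<in> retained_cubes N \<omega> (Suc n)"
    then have "Q \<in> level_cubes N (Suc n)" by (simp add: retained_cubes_def)
    then obtain k R where k: "k \<in> first_digits N" "R \<in> level_cubes N n" "Q = shrink N k ` R"
      by (rule level_cube_Suc_shrink[OF N0])
    have "\<omega> (grid_cube N 1 k)"
      using Q n level_1_cubeI[OF k(1)] shrink_level_cube(2)[OF N0 k(1,2)] k(3)
      unfolding retained_cubes_def by auto
    moreover have "R \<in> retained_cubes N (subtree N k \<omega>) n"
      unfolding retained_cubes_def
    proof (intro CollectI conjI ballI impI)
      show "R \<in> level_cubes N n" by fact
      show "subtree N k \<omega> R" using Q sub[OF k(2) n] k(3) by (simp add: retained_cubes_def)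
      fix m S assume m: "m \<in> {1..<n}" and S: "S \<in> level_cubes N m" "R \<subseteq> S"
      have "shrink N k ` S \<in> level_cubes N (Suc m)" "Q \<subseteq> shrink N k ` S"
        using shrink_level_cube(1)[OF N0 k(1) S(1)] S(2) k(3) by auto
      then have "\<omega> (shrink N k ` S)" using Q m unfolding retained_cubes_def by auto
      then show "subtree N k \<omega> S" using sub[OF S(1)] m by simp
    qed
    ultimately show "Q \<in> (\<Union>k\<in>children N \<omega>. (`) (shrink N k) ` retained_cubes N (subtree N k \<omega>) n)"
      using k unfolding children_def by blast
  next
    fix Q assume "Q \<in> (\<Union>k\<in>children N \<omega>. (`) (shrink N k) ` retained_cubes N (subtree N k \<omega>) n)"
    then obtain k R where k: "k \<in> first_digits N" "\<omega> (grid_cube N 1 k)"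
      "R \<in> retained_cubes N (subtree N k \<omega>) n" "Q = shrink N k ` R"
      unfolding children_def by auto
    have R: "R \<in> level_cubes N n" using k(3) by (simp add: retained_cubes_def)
    show "Q \<in> retained_cubes N \<omega> (Suc n)"
      unfolding retained_cubes_def
    proof (intro CollectI conjI ballI impI)
      show "Q \<in> level_cubes N (Suc n)" using shrink_level_cube(1)[OF N0 k(1) R] k(4) by simp
      show "\<omega> Q" using k(3,4) sub[OF R n] by (simp add: retained_cubes_def)
      fix m S assume m: "m \<in> {1..<Suc n}" and S: "S \<in> level_cubes N m" "Q \<subseteq> S"
      then have "S \<in> level_cubes N (Suc (m - 1))" by simp
      then obtain k' S' where k': "k' \<in> first_digits N" "S' \<in> level_cubes N (m - 1)" "S = shrink N k' ` S'"
        by (rule level_cube_Suc_shrink[OF N0])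
      \<comment> \<open>Uniqueness of the first-generation ancestor forces \<open>S\<close> into the
        branch of \<open>Q\<close>.\<close>
      have "Q \<subseteq> grid_cube N 1 k'" using S(2) k'(3) shrink_level_cube(2)[OF N0 k'(1,2)] by simp
      then have kk: "k = k'" using shrink_subset_unique[OF N0 k(1) R] k(4) by simp
      show "\<omega> S"
      proof (cases "m = 1")
        case True
        then obtain l where "S = grid_cube N 1 l" using S(1) level_1_cubeE by metis
        then show ?thesis using shrink_subset_unique[OF N0 k(1) R] S(2) k(2,4) by auto
      next
        case False
        have "R \<subseteq> S'" using S(2) k(4) k'(3) kk inj_image_subset_iff[OF inj_shrink[OF N0]] by metis
        moreover have "m - 1 \<in> {1..<n}" using m False by auto
        ultimately have "subtree N k \<omega> S'" using k(3) k'(2) unfolding retained_cubes_def by blast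
        moreover have "1 \<le> m - 1" using \<open>m - 1 \<in> {1..<n}\<close> by simp
        ultimately show ?thesis using sub[OF k'(2), of k] kk k'(3) by simp
      qed
    qed
  }
qed

lemma retained_cubes_parent:
  fixes \<omega> :: "(real ^ 'd::finite) set \<Rightarrow> bool"
  assumes N: "0 < N" and n: "1 \<le> n" and Q: "Q \<in> retained_cubes N \<omega> (Suc n)"
  shows "\<exists>R\<in>retained_cubes N \<omega> n. Q \<subseteq> R"
proof -
  have "Q \<in> level_cubes N (Suc n)" using Q by (simp add: retained_cubes_def)
  then obtain R where R: "R \<in> level_cubes N n" "Q \<subseteq> R" by (rule level_cube_ancestor[OF N, of _ _ n]) auto
  have above: "\<omega> S" if "m \<in> {1..<Suc n}" "S \<in> level_cubes N m" "Q \<subseteq> S" for m S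
    using Q that unfolding retained_cubes_def by blast
  have "R \<in> retained_cubes N \<omega> n"
    unfolding retained_cubes_def
  proof (intro CollectI conjI ballI impI R)
    show "\<omega> R" using above[OF _ R] n by simp
    show "\<omega> S" if "m \<in> {1..<n}" "S \<in> level_cubes N m" "R \<subseteq> S" for m S
      using above[of m S] that R(2) by auto
  qed
  then show ?thesis using R by blast
qed

lemma approx_set_antimono:
  fixes \<omega> :: "(real ^ 'd::finite) set \<Rightarrow> bool"
  assumes N: "0 < N" and n: "1 \<le> n" and "n \<le> m"
  shows "approx_set N \<omega> m \<subseteq> approx_set N \<omega> n"
  using assms(3)
proof (induction m rule: dec_induct)
  case (step i)
  then have "\<exists>R\<in>retained_cubes N \<omega> i. Q \<subseteq> R" if "Q \<in> retained_cubes N \<omega> (Suc i)" for Q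
    using retained_cubes_parent[OF N _ that] n by simp
  then have "approx_set N \<omega> (Suc i) \<subseteq> approx_set N \<omega> i"
    unfolding approx_set_def by blast
  then show ?case using step by blast
qed simp

lemma retained_cubes_empty_mono:
  fixes \<omega> :: "(real ^ 'd::finite) set \<Rightarrow> bool"
  assumes N: "0 < N" and n: "1 \<le> n" and "n \<le> m" and "retained_cubes N \<omega> n = {}"
  shows "retained_cubes N \<omega> m = {}"
  using assms(3)
proof (induction m rule: dec_induct)
  case (step i)
  then show ?case using retained_cubes_parent[OF N, of i _ \<omega>] n by fastforce
qed (fact assms)

lemma compact_approx_set:
  "0 < N \<Longrightarrow> compact (approx_set N \<omega> n :: (real ^ 'd::finite) set)"
  unfolding approx_set_def using retained_cubes_level level_cube_props(1)
  by (intro compact_Union finite_retained_cubes) blast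

lemma limit_set_subset: "1 \<le> n \<Longrightarrow> limit_set N \<omega> \<subseteq> approx_set N \<omega> n"
  unfolding limit_set_def approx_set_def by auto

lemma limit_set_eq: "limit_set N \<omega> = (\<Inter>n. approx_set N \<omega> (Suc n))"
proof -
  have "{1..} = range Suc" by (auto simp: image_iff) (metis Suc_pred' Suc_le_eq)
  then show ?thesis unfolding limit_set_def approx_set_def by auto
qed

lemma shrink_limit_set:
  fixes \<omega> :: "(real ^ 'd::finite) set \<Rightarrow> bool"
  assumes N: "2 \<le> N" and k: "k \<in> children N \<omega>"
  shows "shrink N k ` limit_set N (subtree N k \<omega>) \<subseteq> limit_set N \<omega>"
proof -
  have Suc: "shrink N k ` approx_set N (subtree N k \<omega>) n \<subseteq> approx_set N \<omega> (Suc n)" if "1 \<le> n" for n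
    unfolding approx_set_def retained_cubes_Suc[OF N that] using k by blast
  have "shrink N k x \<in> approx_set N \<omega> (Suc n)" if x: "x \<in> limit_set N (subtree N k \<omega>)" for x n
  proof (cases "n = 0")
    case False
    then show ?thesis using Suc[of n] limit_set_subset[of n N "subtree N k \<omega>"] x by auto
  next
    \<comment> \<open>\<open>retained_cubes_Suc\<close> starts at level 2, so membership at level 1
      is checked directly.\<close>
    case True
    have "x \<in> approx_set N (subtree N k \<omega>) 1" using limit_set_subset[of 1] x by auto
    then obtain Q where Q: "x \<in> Q" "Q \<in> level_cubes N 1"
      unfolding approx_set_def retained_cubes_def by auto
    have "k \<in> first_digits N" using k by (simp add: children_def)
    then have "shrink N k x \<in> grid_cube N 1 k"
      using shrink_level_cube(2)[OF _ _ Q(2), of k] Q N by auto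
    then show ?thesis
      using True k retained_cubes_1[of N \<omega>] unfolding approx_set_def by (auto simp flip: One_nat_def)
  qed
  then show ?thesis unfolding limit_set_eq[of N \<omega>] by blast
qed

section \<open>Nontrivial components seen through finite levels\<close>

lemma nontrivial_part_iff:
  "x \<in> nontrivial_part S \<longleftrightarrow> (\<exists>y. y \<noteq> x \<and> connected_component S x y)"
proof -
  have "x \<in> S \<and> connected_component_set S x \<noteq> {x} \<longleftrightarrow> (\<exists>y. y \<noteq> x \<and> connected_component S x y)"
    using connected_component_refl[of x S] connected_component_in[of S x] by blast
  then show ?thesis unfolding nontrivial_part_def by simp
qed

text \<open>A nontrivial component is witnessed by two points of a connected set: continuity keeps
  the set connected and injectivity keeps the points apart.\<close>

lemma nontrivial_part_image:
  assumes "continuous_on S f" "inj f" "f ` S \<subseteq> T"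
  shows "f ` nontrivial_part S \<subseteq> nontrivial_part T"
proof
  fix z assume "z \<in> f ` nontrivial_part S"
  then obtain x y where "z = f x" "y \<noteq> x" "connected_component S x y"
    by (auto simp: nontrivial_part_iff)
  moreover then obtain K where K: "connected K" "K \<subseteq> S" "x \<in> K" "y \<in> K"
    unfolding connected_component_def by blast
  moreover have "connected (f ` K)"
    using K assms(1) by (intro connected_continuous_image) (auto intro: continuous_on_subset)
  ultimately have "connected_component T z (f y)" "f y \<noteq> z"
    using assms(3) injD[OF assms(2)] unfolding connected_component_def by blast+
  then show "z \<in> nontrivial_part T" unfolding nontrivial_part_iff by blast
qed

text \<open>For \<open>1 \<le> n\<close> this depends on finitely many cubes and is thus an event,
  which is not clear for the existence of a nontrivial component of the limit set.\<close>

definition linked :: "nat \<Rightarrow> real \<Rightarrow> nat \<Rightarrow> ((real ^ 'd) set \<Rightarrow> bool) \<Rightarrow> bool" where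
  "linked N e n \<omega> \<longleftrightarrow> (\<exists>x y. e \<le> dist x y \<and> connected_component (approx_set N \<omega> n) x y)"

lemma linked_if_nontrivial:
  assumes "nontrivial_part (limit_set N \<omega>) \<noteq> {}"
  shows "\<exists>i. \<forall>n\<ge>1. linked N (inverse (real (Suc i))) n \<omega>"
proof -
  obtain x y where xy: "y \<noteq> x" "connected_component (limit_set N \<omega>) x y"
    using assms by (auto simp: nontrivial_part_iff)
  then obtain i where "inverse (real (Suc i)) < dist x y"
    using reals_Archimedean[of "dist x y"] by auto
  moreover have "connected_component (approx_set N \<omega> n) x y" if "1 \<le> n" for n
    using connected_component_of_subset[OF xy(2) limit_set_subset[OF that]] .
  ultimately show ?thesis unfolding linked_def by (meson less_imp_le)
qed

text \<open>Compactness is used twice: the nested compact sets of distant connected pairs have a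
  common pair, and the nested components of its first point intersect in a connected set containing
  both points.\<close>

lemma nontrivial_if_linked:
  fixes \<omega> :: "(real ^ 'd::finite) set \<Rightarrow> bool"
  assumes N: "0 < N" and e: "0 < e" and linked: "\<And>n. 1 \<le> n \<Longrightarrow> linked N e n \<omega>"
  shows "nontrivial_part (limit_set N \<omega>) \<noteq> {}"
proof -
  define A where "A n = approx_set N \<omega> (Suc n)" for n
  define F where "F n = {z. connected_component (A n) (fst z) (snd z)} \<inter> {z. e \<le> dist (fst z) (snd z)}" for n
  have A_anti: "A n \<subseteq> A m" if "m \<le> n" for m n
    unfolding A_def using that by (intro approx_set_antimono N) auto
  have A_comp: "compact (A n)" for n unfolding A_def by (rule compact_approx_set[OF N])
  have "(\<Inter>n. F n) \<noteq> {}"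
  proof (rule compact_nest)
    fix n
    let ?R = "retained_cubes N \<omega> (Suc n)"
    let ?P = "{(Q, Q'). Q \<in> ?R \<and> Q' \<in> ?R \<and> (\<exists>x\<in>Q. \<exists>y\<in>Q'. connected_component (A n) x y)}"
    have cube: "compact Q" "connected Q" if "Q \<in> ?R" for Q
      using that retained_cubes_level level_cube_props[OF N] by blast+
    have cc: "connected_component (A n) x y" if "Q \<in> ?R" "x \<in> Q" "y \<in> Q" for Q x y
      using that cube(2) unfolding connected_component_def A_def approx_set_def by blast
    \<comment> \<open>Cubes are connected, so whether two points are connected in \<open>A n\<close>
      is decided by the cubes containing them. The relation is a finite union of products of cubes
      and hence compact.\<close>
    have "{z. connected_component (A n) (fst z) (snd z)} = (\<Union>(Q, Q')\<in>?P. Q \<times> Q')"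
    proof (intro equalityI subsetI)
      fix z assume "z \<in> {z. connected_component (A n) (fst z) (snd z)}"
      then have z: "connected_component (A n) (fst z) (snd z)" by simp
      then have "fst z \<in> A n" "snd z \<in> A n" using connected_component_in by fast+
      then obtain Q Q' where "fst z \<in> Q" "Q \<in> ?R" "snd z \<in> Q'" "Q' \<in> ?R"
        unfolding A_def approx_set_def by auto
      then show "z \<in> (\<Union>(Q, Q')\<in>?P. Q \<times> Q')" using z
        by (intro UN_I[of "(Q, Q')"]) (auto simp: mem_Times_iff)
    next
      fix z assume "z \<in> (\<Union>(Q, Q')\<in>?P. Q \<times> Q')"
      then obtain Q Q' x y where q: "fst z \<in> Q" "Q \<in> ?R" "snd z \<in> Q'" "Q' \<in> ?R" "x \<in> Q" "y \<in> Q'"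
        "connected_component (A n) x y"
        by (auto simp: mem_Times_iff)
      have "connected_component (A n) (fst z) x" "connected_component (A n) y (snd z)"
        using cc q by blast+
      then show "z \<in> {z. connected_component (A n) (fst z) (snd z)}"
        using q(7) connected_component_trans by (metis mem_Collect_eq)
    qed
    moreover have "finite ?P"
      by (rule finite_subset[of _ "?R \<times> ?R"]) (auto intro: finite_retained_cubes)
    then have "compact (\<Union>(Q, Q')\<in>?P. Q \<times> Q')"
      by (rule compact_UN) (auto intro!: compact_Times cube)
    moreover have "closed {z :: (real ^ 'd) \<times> (real ^ 'd). e \<le> dist (fst z) (snd z)}"
      by (intro closed_Collect_le continuous_intros)
    ultimately show "compact (F n)" unfolding F_def by (simp add: compact_Int_closed)
    obtain x y where "e \<le> dist x y" "connected_component (A n) x y"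
      using linked[of "Suc n"] unfolding linked_def A_def by auto
    then have "(x, y) \<in> F n" unfolding F_def by simp
    then show "F n \<noteq> {}" by blast
  next
    fix m n :: nat assume "m \<le> n"
    then show "F n \<subseteq> F m" unfolding F_def
      using connected_component_of_subset[OF _ A_anti] by blast
  qed
  then obtain x y where xy: "\<And>n. connected_component (A n) x y" "e \<le> dist x y"
    unfolding F_def by fastforce
  define K where "K n = connected_component_set (A n) x" for n
  have "connected (\<Inter>n. K n)"
  proof (rule connected_nest)
    fix n show "compact (K n)"
      unfolding K_def compact_eq_bounded_closed
      using bounded_subset[OF compact_imp_bounded[OF A_comp] connected_component_subset]
        closed_connected_component[OF compact_imp_closed[OF A_comp]] by blast
    show "connected (K n)" unfolding K_def by simp
  next
    fix m n :: nat assume "m \<le> n"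
    then show "K n \<subseteq> K m" unfolding K_def by (intro connected_component_mono A_anti)
  qed
  moreover have "(\<Inter>n. K n) \<subseteq> limit_set N \<omega>"
    using connected_component_subset unfolding K_def limit_set_eq A_def by fast
  moreover have "x \<in> (\<Inter>n. K n)" "y \<in> (\<Inter>n. K n)"
    using xy(1) connected_component_in unfolding K_def by (fastforce intro: connected_component_refl)+
  ultimately have "connected_component (limit_set N \<omega>) x y" unfolding connected_component_def by blast
  moreover have "y \<noteq> x" using xy(2) e by auto
  ultimately have "x \<in> nontrivial_part (limit_set N \<omega>)" unfolding nontrivial_part_iff by blast
  then show ?thesis by blast
qed

section \<open>Self-similarity of the percolation measure\<close>

lemma depends_on_retained_cubes:
  assumes "1 \<le> n"
  shows "depends_on (\<lambda>\<omega>. retained_cubes N \<omega> n) (\<Union>m\<in>{1..n}. level_cubes N m)"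
proof (rule depends_onI)
  fix \<omega> \<omega>' :: "(real ^ 'd) set \<Rightarrow> bool"
  assume eq: "\<And>Q. Q \<in> (\<Union>m\<in>{1..n}. level_cubes N m) \<Longrightarrow> \<omega> Q = \<omega>' Q"
  have "\<omega> Q = \<omega>' Q" if "m \<in> {1..n}" "Q \<in> level_cubes N m" for Q m using eq that by blast
  then show "retained_cubes N \<omega> n = retained_cubes N \<omega>' n"
    unfolding retained_cubes_def using assms
    by (intro Collect_cong conj_cong ball_cong imp_cong refl)
      (metis atLeastAtMost_iff order_refl, metis atLeastAtMost_iff atLeastLessThan_iff less_imp_le)
qed

lemma subtree_depends_on:
  "depends_on (\<lambda>\<omega>. f (subtree N k \<omega>)) ((`) (shrink N k) ` all_cubes N)"
proof (rule depends_onI)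
  fix \<omega> \<omega>' :: "(real ^ 'a) set \<Rightarrow> bool"
  assume "\<And>Q. Q \<in> (`) (shrink N k) ` all_cubes N \<Longrightarrow> \<omega> Q = \<omega>' Q"
  then have "subtree N k \<omega> = subtree N k \<omega>'"
    unfolding subtree_def by (intro restrict_ext) blast
  then show "f (subtree N k \<omega>) = f (subtree N k \<omega>')" by simp
qed

text \<open>The coordinates read by the branch through the first-generation cube
  \<open>k\<close>.\<close>

definition family :: "nat \<Rightarrow> ('d::finite \<Rightarrow> nat) \<Rightarrow> (real ^ 'd) set set" where
  "family N k = insert (grid_cube N 1 k) ((`) (shrink N k) ` all_cubes N)"

lemma shrink_all_cubes:
  assumes "0 < N" "k \<in> first_digits N"
  shows "(`) (shrink N k) ` all_cubes N \<subseteq> all_cubes N"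
  using shrink_level_cube(1)[OF assms] unfolding all_cubes_def by fastforce

lemma family_subset:
  assumes "0 < N" "k \<in> first_digits N"
  shows "family N k \<subseteq> all_cubes N"
  using shrink_all_cubes[OF assms] level_1_cubeI[OF assms(2)] level_cubes_subset_all[of 1 N]
  unfolding family_def by auto

text \<open>A cube lies in one first-generation cube only. This is the source of the independence of
  distinct branches.\<close>

lemma disjoint_family:
  assumes N: "0 < N"
  shows "disjoint_family_on (family N) (first_digits N)"
proof -
  have sub: "Q \<subseteq> grid_cube N 1 k" "\<exists>n. Q \<in> level_cubes N n"
    if k: "k \<in> first_digits N" and Q: "Q \<in> family N k" for k and Q :: "(real ^ 'a) set"
  proof -
    have "Q \<subseteq> grid_cube N 1 k \<and> (\<exists>n. Q \<in> level_cubes N n)"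
      using Q level_1_cubeI[OF k] shrink_level_cube[OF N k] unfolding family_def all_cubes_def by blast
    then show "Q \<subseteq> grid_cube N 1 k" "\<exists>n. Q \<in> level_cubes N n" by auto
  qed
  show ?thesis
    unfolding disjoint_family_on_def
  proof (intro ballI impI)
    fix k k' :: "'a \<Rightarrow> nat"
    assume k: "k \<in> first_digits N" "k' \<in> first_digits N" "k \<noteq> k'"
    have False if Q: "Q \<in> family N k" "Q \<in> family N k'" for Q
    proof -
      obtain n l where "Q = grid_cube N n l" using sub(2)[OF k(1) Q(1)] by (meson level_cubesE)
      then show False
        using grid_cube_subset_unique[OF N] sub(1)[OF k(1) Q(1)] sub(1)[OF k(2) Q(2)] k(3) by blast
    qed
    then show "family N k \<inter> family N k' = {}" by blast
  qed
qed

text \<open>Every image has level at least 2. Consequently the state of a first-generation cube is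
  independent of the configuration below it.\<close>

lemma parent_not_in_shrink:
  assumes N: "2 \<le> N" and k: "k \<in> first_digits N"
  shows "grid_cube N 1 k \<notin> (`) (shrink N k) ` all_cubes N"
proof
  assume "grid_cube N 1 k \<in> (`) (shrink N k) ` all_cubes N"
  then obtain n R where R: "1 \<le> n" "R \<in> level_cubes N n" "grid_cube N 1 k = shrink N k ` R"
    unfolding all_cubes_def by auto
  then have "grid_cube N 1 k \<in> level_cubes N (Suc n)"
    using shrink_level_cube(1)[OF _ k R(2)] N by simp
  then show False using level_cubes_disjoint[OF N _ level_1_cubeI[OF k]] R(1) by fastforce
qed

text \<open>\<open>M\<close> is tied to \<open>percolation N p\<close> by an equation, so that an
  interpretation can use a nonnegative parameter while keeping the measure as originally
  written.\<close>

locale fractal_percolation =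
  fixes N :: nat and p :: real and M :: "((real ^ 'd::finite) set \<Rightarrow> bool) measure"
  assumes N: "2 \<le> N" and p: "0 \<le> p" "p < 1" and M_eq: "M = percolation N p"
begin

lemma N0: "0 < N" using N by simp

lemma M_PiM: "M = PiM (all_cubes N) (\<lambda>_. measure_pmf (bernoulli_pmf p))"
  unfolding M_eq percolation_def ..

sublocale prob_space M
  unfolding M_PiM by (intro prob_space_PiM measure_pmf.prob_space_axioms)

lemma indep_vars_percolation:
  assumes "\<And>l. l \<in> L \<Longrightarrow> f l \<in> measurable M (S l)"
    and "\<And>l. l \<in> L \<Longrightarrow> depends_on (f l) (K l)"
    and "\<And>l. l \<in> L \<Longrightarrow> K l \<subseteq> all_cubes N" and "disjoint_family_on K L"
  shows "indep_vars S f L"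
  using assms unfolding M_PiM
  by (intro indep_vars_depends_on[where K = K] all_cubes_nonempty N0) (auto simp: measure_pmf.prob_space_axioms)

lemma prob_Ball:
  assumes L: "finite L" and meas: "\<And>l. l \<in> L \<Longrightarrow> {\<omega> \<in> space M. E l \<omega>} \<in> sets M"
    and dep: "\<And>l. l \<in> L \<Longrightarrow> depends_on (E l) (K l)"
    and K: "\<And>l. l \<in> L \<Longrightarrow> K l \<subseteq> all_cubes N" and disj: "disjoint_family_on K L"
  shows "prob {\<omega> \<in> space M. \<forall>l\<in>L. E l \<omega>} = (\<Prod>l\<in>L. prob {\<omega> \<in> space M. E l \<omega>})"
proof (cases "L = {}")
  case False
  have "indep_vars (\<lambda>_. count_space UNIV) E L"
    using meas by (intro indep_vars_percolation[OF _ dep K disj]) (auto simp: pred_def)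
  from indep_varsD_finite[OF this False L, of "\<lambda>_. {True}"]
  have "prob (\<Inter>l\<in>L. E l -` {True} \<inter> space M) = (\<Prod>l\<in>L. prob (E l -` {True} \<inter> space M))" by simp
  moreover have "E l -` {True} \<inter> space M = {\<omega> \<in> space M. E l \<omega>}" for l by auto
  moreover have "(\<Inter>l\<in>L. {\<omega> \<in> space M. E l \<omega>}) = {\<omega> \<in> space M. \<forall>l\<in>L. E l \<omega>}" using False by auto
  ultimately show ?thesis by simp
qed (simp add: prob_space)

lemma expectation_mult:
  fixes f g :: "_ \<Rightarrow> real"
  assumes "integrable M f" "integrable M g" "depends_on f K" "depends_on g K'"
    and "K \<subseteq> all_cubes N" "K' \<subseteq> all_cubes N" "K \<inter> K' = {}"
  shows "expectation (\<lambda>\<omega>. f \<omega> * g \<omega>) = expectation f * expectation g"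
proof -
  have "indep_vars (\<lambda>_. borel) (\<lambda>b. if b then f else g) UNIV"
    using assms by (intro indep_vars_percolation[where K = "\<lambda>b. if b then K else K'"])
      (auto simp: disjoint_family_on_def)
  from indep_vars_lebesgue_integral[OF _ this] assms(1,2)
  show ?thesis by (simp add: UNIV_bool mult.commute)
qed

lemma sets_depends_on:
  assumes "depends_on P J" "finite J" "J \<subseteq> all_cubes N"
  shows "{\<omega> \<in> space M. P \<omega>} \<in> sets M"
  using sets_depends_on_finite[OF assms] unfolding M_PiM by simp

lemma prob_cube:
  assumes Q: "Q \<in> all_cubes N"
  shows "prob {\<omega> \<in> space M. \<omega> Q} = p"
proof -
  let ?B = "measure_pmf (bernoulli_pmf p)"
  have d: "distr M ?B (\<lambda>\<omega>. \<omega> Q) = ?B"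
    unfolding M_PiM using Q by (intro distr_PiM_component) (auto simp: measure_pmf.prob_space_axioms)
  have m: "(\<lambda>\<omega>. \<omega> Q) \<in> measurable M ?B"
    unfolding M_PiM using Q by (rule measurable_component_singleton)
  have "p = measure ?B {True}" using p by (simp add: measure_pmf_single)
  also have "\<dots> = prob ((\<lambda>\<omega>. \<omega> Q) -` {True} \<inter> space M)"
    using measure_distr[OF m, of "{True}"] d by simp
  also have "(\<lambda>\<omega>. \<omega> Q) -` {True} \<inter> space M = {\<omega> \<in> space M. \<omega> Q}" by auto
  finally show ?thesis ..
qed

lemma measurable_cube:
  assumes "Q \<in> all_cubes N"
  shows "Measurable.pred M (\<lambda>\<omega>. \<omega> Q)"
  unfolding pred_def
  by (rule sets_depends_on[of _ "{Q}"]) (use assms in \<open>auto simp: depends_on_def\<close>)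

lemma prob_all_cubes_off:
  assumes "finite J" "J \<subseteq> all_cubes N"
  shows "prob {\<omega> \<in> space M. \<forall>Q\<in>J. \<not> \<omega> Q} = (1 - p) ^ card J"
proof -
  have "prob {\<omega> \<in> space M. \<forall>Q\<in>J. \<not> \<omega> Q} = (\<Prod>Q\<in>J. prob {\<omega> \<in> space M. \<not> \<omega> Q})"
    using assms by (intro prob_Ball[where K = "\<lambda>Q. {Q}"])
      (auto simp: depends_on_def disjoint_family_on_def intro!: sets_depends_on[of _ "{_}"])
  also have "\<dots> = (\<Prod>Q\<in>J. 1 - p)"
  proof (rule prod.cong)
    fix Q assume "Q \<in> J"
    then show "prob {\<omega> \<in> space M. \<not> \<omega> Q} = 1 - p"
      using prob_cube prob_neg[of "\<lambda>\<omega>. \<omega> Q"] measurable_cube assms by (auto simp: pred_def)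
  qed simp
  finally show ?thesis by simp
qed

lemma subtree_measurable:
  assumes k: "k \<in> first_digits N"
  shows "subtree N k \<in> measurable M M"
  unfolding subtree_def M_PiM using shrink_all_cubes[OF N0 k]
  by (intro measurable_restrict measurable_component_singleton) auto

text \<open>Statistical self-similarity: reindexing an i.i.d. family along an injection preserves
  its law.\<close>

lemma distr_subtree:
  assumes k: "k \<in> first_digits N"
  shows "distr M M (subtree N k) = M"
proof -
  have "inj_on ((`) (shrink N k)) (all_cubes N)"
    by (rule inj_onI) (simp only: inj_image_eq_iff[OF inj_shrink[OF N0]])
  moreover have "(`) (shrink N k) \<in> all_cubes N \<rightarrow> all_cubes N"
    using shrink_all_cubes[OF N0 k] by auto
  ultimately show ?thesis
    unfolding subtree_def M_PiM
    by (intro distr_PiM_reindex) (auto simp: measure_pmf.prob_space_axioms)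
qed

lemma expectation_subtree:
  fixes f :: "_ \<Rightarrow> real"
  assumes k: "k \<in> first_digits N" and f: "f \<in> borel_measurable M"
  shows "expectation (\<lambda>\<omega>. f (subtree N k \<omega>)) = expectation f"
  using integral_distr[OF subtree_measurable[OF k] f] distr_subtree[OF k] by simp

end

section \<open>Sums over the first generation\<close>

text \<open>One generation step of the branching process: marked counts at level
  \<open>Suc n\<close> are branch sums of those at level \<open>n\<close>.\<close>

definition branch_sum :: "nat \<Rightarrow> (((real ^ 'd) set \<Rightarrow> bool) \<Rightarrow> real) \<Rightarrow> ((real ^ 'd::finite) set \<Rightarrow> bool) \<Rightarrow> real" where
  "branch_sum N f \<omega> = (\<Sum>k\<in>children N \<omega>. f (subtree N k \<omega>))"

lemma branch_sum_eq:
  "branch_sum N f \<omega> = (\<Sum>k\<in>first_digits N. of_bool (\<omega> (grid_cube N 1 k)) * f (subtree N k \<omega>))"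
proof -
  have "branch_sum N f \<omega> = (\<Sum>k\<in>first_digits N. if \<omega> (grid_cube N 1 k) then f (subtree N k \<omega>) else 0)"
    unfolding branch_sum_def children_def by (rule sum.inter_filter[OF finite_first_digits])
  also have "\<dots> = (\<Sum>k\<in>first_digits N. of_bool (\<omega> (grid_cube N 1 k)) * f (subtree N k \<omega>))"
    by (intro sum.cong) auto
  finally show ?thesis .
qed

context fractal_percolation
begin

text \<open>A class of integrable variables closed under the operations used below. The bound holds
  for every function, not just on \<open>space M\<close>, so it passes through
  \<open>subtree\<close> pointwise.\<close>

definition bounded_var :: "(((real ^ 'd) set \<Rightarrow> bool) \<Rightarrow> real) \<Rightarrow> bool" where
  "bounded_var f \<longleftrightarrow> f \<in> borel_measurable M \<and> (\<exists>B. \<forall>\<omega>. \<bar>f \<omega>\<bar> \<le> B)"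

lemma bounded_varI: "f \<in> borel_measurable M \<Longrightarrow> (\<And>\<omega>. \<bar>f \<omega>\<bar> \<le> B) \<Longrightarrow> bounded_var f"
  unfolding bounded_var_def by blast

lemma bounded_var_measurable [measurable_dest]: "bounded_var f \<Longrightarrow> f \<in> borel_measurable M"
  unfolding bounded_var_def by blast

lemma bounded_var_integrable:
  assumes "bounded_var f" shows "integrable M f"
proof -
  obtain B where "\<forall>\<omega>. \<bar>f \<omega>\<bar> \<le> B" using assms unfolding bounded_var_def by auto
  then show ?thesis using bounded_var_measurable[OF assms] by (intro integrable_const_bound[of _ B]) auto
qed

lemma bounded_var_mult:
  assumes "bounded_var f" "bounded_var g" shows "bounded_var (\<lambda>\<omega>. f \<omega> * g \<omega>)"
proof -
  obtain B C where "\<forall>\<omega>. \<bar>f \<omega>\<bar> \<le> B" "\<forall>\<omega>. \<bar>g \<omega>\<bar> \<le> C" using assms unfolding bounded_var_def by auto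
  then have "\<bar>f \<omega> * g \<omega>\<bar> \<le> B * C" for \<omega>
    unfolding abs_mult by (intro mult_mono) (auto intro: order_trans[OF abs_ge_zero])
  then show ?thesis using assms bounded_var_measurable by (intro bounded_varI) auto
qed

lemma bounded_var_sum:
  assumes "finite I" "\<And>i. i \<in> I \<Longrightarrow> bounded_var (f i)" shows "bounded_var (\<lambda>\<omega>. \<Sum>i\<in>I. f i \<omega>)"
proof -
  have "\<forall>i\<in>I. \<exists>B. \<forall>\<omega>. \<bar>f i \<omega>\<bar> \<le> B" using assms(2) unfolding bounded_var_def by auto
  then obtain B where B: "\<And>i \<omega>. i \<in> I \<Longrightarrow> \<bar>f i \<omega>\<bar> \<le> B i" by metis
  have "\<bar>\<Sum>i\<in>I. f i \<omega>\<bar> \<le> (\<Sum>i\<in>I. B i)" for \<omega>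
    by (rule order_trans[OF sum_abs sum_mono[OF B]])
  then show ?thesis using assms(2) bounded_var_measurable by (intro bounded_varI borel_measurable_sum) auto
qed

lemma bounded_var_diff:
  assumes "bounded_var f" "bounded_var g" shows "bounded_var (\<lambda>\<omega>. f \<omega> - c * g \<omega>)"
proof -
  obtain B C where BC: "\<forall>\<omega>. \<bar>f \<omega>\<bar> \<le> B" "\<forall>\<omega>. \<bar>g \<omega>\<bar> \<le> C" using assms unfolding bounded_var_def by auto
  have "\<bar>f \<omega> - c * g \<omega>\<bar> \<le> B + \<bar>c\<bar> * C" for \<omega>
  proof -
    have "\<bar>c * g \<omega>\<bar> \<le> \<bar>c\<bar> * C" unfolding abs_mult using BC by (intro mult_left_mono) auto
    then show ?thesis using BC(1)[rule_format, of \<omega>] by linarith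
  qed
  then show ?thesis using assms bounded_var_measurable by (intro bounded_varI) auto
qed

lemma bounded_var_subtree:
  assumes k: "k \<in> first_digits N" and f: "bounded_var f"
  shows "bounded_var (\<lambda>\<omega>. f (subtree N k \<omega>))"
proof -
  obtain B where "\<forall>\<omega>. \<bar>f \<omega>\<bar> \<le> B" using f unfolding bounded_var_def by auto
  then show ?thesis
    using measurable_compose[OF subtree_measurable[OF k] bounded_var_measurable[OF f]]
    by (intro bounded_varI) auto
qed

lemma first_cube_in_all: "k \<in> first_digits N \<Longrightarrow> grid_cube N 1 k \<in> all_cubes N"
  using level_1_cubeI level_cubes_subset_all by blast

lemma bounded_var_of_bool:
  assumes "{\<omega> \<in> space M. E \<omega>} \<in> sets M" shows "bounded_var (\<lambda>\<omega>. of_bool (E \<omega>))"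
  using assms by (intro bounded_varI[of _ 1]) (auto simp: pred_def intro!: measurable_of_bool)

lemma bounded_var_child:
  assumes "k \<in> first_digits N" "bounded_var f"
  shows "bounded_var (\<lambda>\<omega>. of_bool (\<omega> (grid_cube N 1 k)) * f (subtree N k \<omega>))"
  using assms measurable_cube[OF first_cube_in_all[OF assms(1)]]
  by (intro bounded_var_mult bounded_var_subtree bounded_var_of_bool) (auto simp: pred_def)

lemma bounded_var_branch_sum: "bounded_var f \<Longrightarrow> bounded_var (branch_sum N f)"
  unfolding branch_sum_eq[abs_def] by (intro bounded_var_sum finite_first_digits bounded_var_child)

text \<open>The state of the cube is independent of its subtree, and the rescaled subtree has law
  \<open>M\<close>.\<close>

lemma expectation_child:
  assumes k: "k \<in> first_digits N" and f: "bounded_var f"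
  shows "expectation (\<lambda>\<omega>. of_bool (\<omega> (grid_cube N 1 k)) * f (subtree N k \<omega>)) = p * expectation f"
proof -
  let ?Q = "grid_cube N 1 k"
  have Q: "{\<omega> \<in> space M. \<omega> ?Q} \<in> sets M"
    using measurable_cube[OF first_cube_in_all[OF k]] by (simp add: pred_def)
  have "expectation (\<lambda>\<omega>. of_bool (\<omega> ?Q) * f (subtree N k \<omega>))
      = expectation (\<lambda>\<omega>. of_bool (\<omega> ?Q)) * expectation (\<lambda>\<omega>. f (subtree N k \<omega>))"
    using first_cube_in_all[OF k] shrink_all_cubes[OF N0 k] parent_not_in_shrink[OF N k]
    by (intro expectation_mult[where K = "{?Q}" and K' = "(`) (shrink N k) ` all_cubes N"]
        bounded_var_integrable bounded_var_of_bool Q bounded_var_subtree k f subtree_depends_on)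
      (auto simp: depends_on_def)
  also have "expectation (\<lambda>\<omega>. of_bool (\<omega> ?Q)) = expectation (indicator {\<omega> \<in> space M. \<omega> ?Q})"
    by (intro Bochner_Integration.integral_cong) auto
  also have "\<dots> = p" using prob_cube[OF first_cube_in_all[OF k]] Q by simp
  finally show ?thesis using expectation_subtree[OF k bounded_var_measurable[OF f]] by simp
qed

definition mean :: real where "mean = p * real (N ^ CARD('d))"

lemma expectation_branch_sum:
  assumes f: "bounded_var f"
  shows "expectation (branch_sum N f) = mean * expectation f"
proof -
  have "expectation (branch_sum N f)
      = (\<Sum>k\<in>first_digits N. expectation (\<lambda>\<omega>. of_bool (\<omega> (grid_cube N 1 k)) * f (subtree N k \<omega>)))"
    unfolding branch_sum_eq[abs_def]
    by (intro Bochner_Integration.integral_sum bounded_var_integrable bounded_var_child f)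
  also have "\<dots> = (\<Sum>k\<in>(first_digits N :: ('d \<Rightarrow> nat) set). p * expectation f)"
    by (intro sum.cong refl expectation_child f)
  finally show ?thesis by (simp add: card_first_digits mean_def)
qed

lemma child_depends_on:
  fixes k :: "'d \<Rightarrow> nat"
  shows "depends_on (\<lambda>\<omega>. h (\<omega> (grid_cube N 1 k)) (f (subtree N k \<omega>))) (family N k)"
proof (rule depends_onI)
  fix \<omega> \<omega>' :: "(real ^ 'd) set \<Rightarrow> bool"
  assume eq: "\<And>Q. Q \<in> family N k \<Longrightarrow> \<omega> Q = \<omega>' Q"
  then have "f (subtree N k \<omega>) = f (subtree N k \<omega>')"
    by (intro depends_onD[OF subtree_depends_on[of f N k]]) (auto simp: family_def)
  with eq show "h (\<omega> (grid_cube N 1 k)) (f (subtree N k \<omega>)) = h (\<omega>' (grid_cube N 1 k)) (f (subtree N k \<omega>'))"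
    by (simp add: family_def)
qed

text \<open>Distinct branches are independent and \<open>f\<close> is centred, so the mixed terms
  vanish; \<open>N ^ CARD('d)\<close> diagonal terms remain, each with a factor
  \<open>p\<close>.\<close>

lemma expectation_branch_sum_square:
  assumes f: "bounded_var f" and f0: "expectation f = 0"
  shows "expectation (\<lambda>\<omega>. (branch_sum N f \<omega>)\<^sup>2) = mean * expectation (\<lambda>\<omega>. (f \<omega>)\<^sup>2)"
proof -
  let ?D = "first_digits N :: ('d \<Rightarrow> nat) set"
  let ?X = "\<lambda>k \<omega>. of_bool (\<omega> (grid_cube N 1 k)) * f (subtree N k \<omega>)"
  have f2: "bounded_var (\<lambda>\<omega>. (f \<omega>)\<^sup>2)" using bounded_var_mult[OF f f] by (simp add: power2_eq_square)
  have prod: "expectation (\<lambda>\<omega>. ?X k \<omega> * ?X l \<omega>)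
      = (if k = l then p * expectation (\<lambda>\<omega>. (f \<omega>)\<^sup>2) else 0)" if kl: "k \<in> ?D" "l \<in> ?D" for k l
  proof (cases "k = l")
    case True
    have "(\<lambda>\<omega>. ?X k \<omega> * ?X k \<omega>) = (\<lambda>\<omega>. of_bool (\<omega> (grid_cube N 1 k)) * (f (subtree N k \<omega>))\<^sup>2)"
      by (auto simp: power2_eq_square)
    then show ?thesis using expectation_child[OF kl(1) f2] True by simp
  next
    case False
    have "expectation (\<lambda>\<omega>. ?X k \<omega> * ?X l \<omega>) = expectation (?X k) * expectation (?X l)"
      using False kl disjoint_family[OF N0] family_subset[OF N0]
      by (intro expectation_mult[where K = "family N k" and K' = "family N l"] bounded_var_integrable
          bounded_var_child f child_depends_on[where h = "\<lambda>a b. of_bool a * b"])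
        (auto simp: disjoint_family_on_def)
    then show ?thesis using expectation_child[OF kl(1) f] f0 False by simp
  qed
  have "expectation (\<lambda>\<omega>. (branch_sum N f \<omega>)\<^sup>2) = expectation (\<lambda>\<omega>. \<Sum>k\<in>?D. \<Sum>l\<in>?D. ?X k \<omega> * ?X l \<omega>)"
    unfolding branch_sum_eq power2_eq_square sum_product ..
  also have "\<dots> = (\<Sum>k\<in>?D. \<Sum>l\<in>?D. expectation (\<lambda>\<omega>. ?X k \<omega> * ?X l \<omega>))"
    by (subst Bochner_Integration.integral_sum)
       (auto intro!: sum.cong Bochner_Integration.integral_sum bounded_var_integrable bounded_var_sum
         bounded_var_mult bounded_var_child f finite_first_digits simp del: One_nat_def)
  also have "\<dots> = (\<Sum>k\<in>?D. \<Sum>l\<in>?D. if k = l then p * expectation (\<lambda>\<omega>. (f \<omega>)\<^sup>2) else 0)"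
    by (intro sum.cong refl prod)
  also have "\<dots> = mean * expectation (\<lambda>\<omega>. (f \<omega>)\<^sup>2)"
    by (simp add: finite_first_digits card_first_digits mean_def)
  finally show ?thesis .
qed

end

text \<open>With the unit cube counted as retained, these are the retained cubes of level
  \<open>n\<close> whose rescaled subtree satisfies \<open>A\<close>. Recursing through the first
  generation lets the counts inherit the moment formulas of \<open>branch_sum\<close>.\<close>

primrec marked :: "nat \<Rightarrow> (((real ^ 'd) set \<Rightarrow> bool) \<Rightarrow> bool) \<Rightarrow> nat \<Rightarrow> ((real ^ 'd::finite) set \<Rightarrow> bool) \<Rightarrow> (real ^ 'd) set set" where
  "marked N A 0 \<omega> = (if A \<omega> then {grid_cube N 0 (\<lambda>_. 1)} else {})"
| "marked N A (Suc n) \<omega> = (\<Union>k\<in>children N \<omega>. (`) (shrink N k) ` marked N A n (subtree N k \<omega>))"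

declare marked.simps(2) [simp del]

lemma marked_level:
  assumes N: "0 < N" shows "marked N A n \<omega> \<subseteq> level_cubes N n"
proof (induction n arbitrary: \<omega>)
  case 0
  show ?case using level_cubesI[of "\<lambda>_. 1" N 0] by auto
next
  case (Suc n)
  show ?case using shrink_level_cube(1)[OF N] Suc.IH unfolding marked.simps children_def by blast
qed

lemma finite_marked: "0 < N \<Longrightarrow> finite (marked N A n \<omega>)"
  using marked_level finite_level_cubes finite_subset by metis

text \<open>Images under distinct children lie in distinct first-generation cubes, so the union is
  disjoint, and \<open>shrink\<close> is injective on each piece.\<close>

lemma card_marked_Suc:
  assumes N: "0 < N"
  shows "real (card (marked N A (Suc n) \<omega>)) = branch_sum N (\<lambda>\<omega>. real (card (marked N A n \<omega>))) \<omega>"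
proof -
  have "card (marked N A (Suc n) \<omega>) = (\<Sum>k\<in>children N \<omega>. card ((`) (shrink N k) ` marked N A n (subtree N k \<omega>)))"
    unfolding marked.simps
  proof (rule card_UN_disjoint)
    show "finite (children N \<omega>)" unfolding children_def by (simp add: finite_first_digits)
    show "\<forall>k\<in>children N \<omega>. finite ((`) (shrink N k) ` marked N A n (subtree N k \<omega>))"
      using finite_marked[OF N] by blast
    show "\<forall>k\<in>children N \<omega>. \<forall>k'\<in>children N \<omega>. k \<noteq> k' \<longrightarrow>
      (`) (shrink N k) ` marked N A n (subtree N k \<omega>) \<inter> (`) (shrink N k') ` marked N A n (subtree N k' \<omega>) = {}"
    proof (intro ballI impI, rule ccontr)
      fix k k' assume k: "k \<in> children N \<omega>" "k' \<in> children N \<omega>" "k \<noteq> k'"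
        and "(`) (shrink N k) ` marked N A n (subtree N k \<omega>) \<inter> (`) (shrink N k') ` marked N A n (subtree N k' \<omega>) \<noteq> {}"
      then obtain Q R where Q: "Q \<in> level_cubes N n" "R \<in> level_cubes N n" "shrink N k ` Q = shrink N k' ` R"
        using marked_level[OF N, of A n] by blast
      then show False
        using shrink_subset_unique[OF N _ Q(1)] shrink_level_cube(2)[OF N _ Q(2)] k unfolding children_def by simp
    qed
  qed
  also have "\<dots> = (\<Sum>k\<in>children N \<omega>. card (marked N A n (subtree N k \<omega>)))"
    by (intro sum.cong refl card_image inj_onI) (simp only: inj_image_eq_iff[OF inj_shrink[OF N]])
  finally show ?thesis unfolding branch_sum_def by simp
qed

text \<open>The similarities carry a nontrivial component in the rescaled subtree of a retained cube
  to a connected set with more than one point in the whole limit set.\<close>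

lemma marked_meets_nontrivial:
  assumes N: "2 \<le> N" and A: "\<And>\<omega>. A \<omega> \<Longrightarrow> nontrivial_part (limit_set N \<omega>) \<noteq> {}"
    and "Q \<in> marked N A n \<omega>"
  shows "Q \<inter> nontrivial_part (limit_set N \<omega>) \<noteq> {}"
  using assms(3)
proof (induction n arbitrary: \<omega> Q)
  case 0
  then have A': "A \<omega>" "Q = grid_cube N 0 (\<lambda>_. 1)" by (auto split: if_splits)
  obtain x where x: "x \<in> nontrivial_part (limit_set N \<omega>)" using A[OF A'(1)] by blast
  then have "x \<in> approx_set N \<omega> 1"
    using limit_set_subset[of 1 N \<omega>] unfolding nontrivial_part_def by auto
  then obtain R where R: "R \<in> level_cubes N 1" "x \<in> R"
    unfolding approx_set_def retained_cubes_def by auto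
  have "x \<in> Q" using level_cube_unit[OF _ R, of] N unfolding A'(2) by (simp add: mem_grid_cube)
  then show ?case using x by blast
next
  case (Suc n)
  then obtain k R where k: "k \<in> children N \<omega>" "R \<in> marked N A n (subtree N k \<omega>)" "Q = shrink N k ` R"
    unfolding marked.simps by auto
  obtain x where "x \<in> R" "x \<in> nontrivial_part (limit_set N (subtree N k \<omega>))" using Suc.IH[OF k(2)] by blast
  moreover have "shrink N k ` nontrivial_part (limit_set N (subtree N k \<omega>)) \<subseteq> nontrivial_part (limit_set N \<omega>)"
    using N by (intro nontrivial_part_image continuous_shrink inj_shrink shrink_limit_set k) auto
  ultimately show ?case using k(3) by blast
qed

section \<open>Growth of the number of marked cubes\<close>

text \<open>Strict convexity of \<open>x \<mapsto> (1 - p * x) ^ m\<close>, which meets the line \<open>1 - x\<close> at \<open>0\<close>.\<close>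

lemma generating_function_fixed_point_unique:
  fixes p g s :: real
  assumes p: "0 < p" "p \<le> 1" and g: "0 < g" and s: "s \<le> 1" and m: "2 \<le> m"
    and below: "1 - g \<le> (1 - p * g) ^ m" and above: "(1 - p * s) ^ m \<le> 1 - s"
  shows "s \<le> g"
proof (rule ccontr)
  assume "\<not> s \<le> g"
  then have gs: "g < s" by simp
  define x where "x = 1 - p * g"
  define y where "y = 1 - p * s"
  have "p * s \<le> 1 * 1" using p s gs g by (intro mult_mono) auto
  then have y0: "0 \<le> y" by (simp add: y_def)
  have yx: "y < x" using p gs by (simp add: x_def y_def)
  have "1 - x ^ m \<le> g" using below by (simp add: x_def)
  \<comment> \<open>The factorisation \<open>1 - x ^ m = (1 - x) * (\<Sum>i<m. x ^ i)\<close>,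
    divided by \<open>g\<close> or \<open>s\<close>, makes \<open>p\<close> times the geometric sum
    at most 1 at \<open>x\<close> and at least 1 at \<open>y\<close>, although
    \<open>y < x\<close>.\<close>
  then have "(p * g) * (\<Sum>i<m. x ^ i) \<le> g" unfolding one_diff_power_eq by (simp add: x_def)
  then have "p * (\<Sum>i<m. x ^ i) \<le> 1" using g by (simp add: mult.assoc mult.left_commute[of p g])
  moreover have "s \<le> 1 - y ^ m" using above by (simp add: y_def)
  then have "s \<le> (p * s) * (\<Sum>i<m. y ^ i)" unfolding one_diff_power_eq by (simp add: y_def)
  then have "1 \<le> p * (\<Sum>i<m. y ^ i)" using g gs by (simp add: mult.assoc mult.left_commute[of p s])
  moreover have "(\<Sum>i<m. y ^ i) < (\<Sum>i<m. x ^ i)"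
  proof (rule sum_strict_mono_ex1)
    show "\<forall>i\<in>{..<m}. y ^ i \<le> x ^ i" using y0 yx by (auto intro: power_mono)
    show "\<exists>i\<in>{..<m}. y ^ i < x ^ i" using yx m by (intro bexI[of _ 1]) auto
  qed simp
  then have "p * (\<Sum>i<m. y ^ i) < p * (\<Sum>i<m. x ^ i)" using p by simp
  ultimately show False by linarith
qed

context fractal_percolation
begin

abbreviation marked_count :: "(((real ^ 'd) set \<Rightarrow> bool) \<Rightarrow> bool) \<Rightarrow> nat \<Rightarrow> ((real ^ 'd) set \<Rightarrow> bool) \<Rightarrow> real" where
  "marked_count A n \<omega> \<equiv> real (card (marked N A n \<omega>))"

text \<open>The constant is a natural number so that the event is a countable combination of
  conditions on the counts.\<close>

definition fast_growth :: "(((real ^ 'd) set \<Rightarrow> bool) \<Rightarrow> bool) \<Rightarrow> ((real ^ 'd) set \<Rightarrow> bool) \<Rightarrow> bool" where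
  "fast_growth A \<omega> \<longleftrightarrow> (\<exists>i::nat. \<forall>\<^sub>F n in sequentially. mean ^ n \<le> real (Suc i) * marked_count A n \<omega>)"

definition extinct :: "((real ^ 'd) set \<Rightarrow> bool) \<Rightarrow> bool" where
  "extinct \<omega> \<longleftrightarrow> (\<exists>n\<ge>1. retained_cubes N \<omega> n = {})"

lemma mean_nonneg: "0 \<le> mean"
  unfolding mean_def using p by simp

text \<open>The branches are independent, and each succeeds with probability \<open>p\<close> times
  that of \<open>E\<close>. The resulting power is the generating function of the binomial number of
  children, taken at the probability that \<open>E\<close> fails.\<close>

lemma prob_children:
  assumes E: "{\<omega> \<in> space M. E \<omega>} \<in> sets M"
  shows "{\<omega> \<in> space M. \<forall>k\<in>first_digits N. \<not> (\<omega> (grid_cube N 1 k) \<and> E (subtree N k \<omega>))} \<in> sets M"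
    and "prob {\<omega> \<in> space M. \<forall>k\<in>first_digits N. \<not> (\<omega> (grid_cube N 1 k) \<and> E (subtree N k \<omega>))}
      = (1 - p * prob {\<omega> \<in> space M. E \<omega>}) ^ (N ^ CARD('d))"
proof -
  let ?F = "\<lambda>k \<omega>. \<omega> (grid_cube N 1 k) \<and> E (subtree N k \<omega>)"
  have F: "{\<omega> \<in> space M. ?F k \<omega>} \<in> sets M" if k: "k \<in> first_digits N" for k
  proof -
    have [measurable]: "Measurable.pred M (\<lambda>\<omega>. \<omega> (grid_cube N 1 k))"
      by (rule measurable_cube[OF first_cube_in_all[OF k]])
    have [measurable]: "Measurable.pred M (\<lambda>\<omega>. E (subtree N k \<omega>))"
      using measurable_compose[OF subtree_measurable[OF k], of E "count_space UNIV"] E by (simp add: pred_def)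
    show ?thesis by measurable
  qed
  then show "{\<omega> \<in> space M. \<forall>k\<in>first_digits N. \<not> ?F k \<omega>} \<in> sets M"
    by (intro sets.sets_Collect_finite_All sets.sets_Collect_neg finite_first_digits)
  have p1: "prob {\<omega> \<in> space M. \<not> ?F k \<omega>} = 1 - p * prob {\<omega> \<in> space M. E \<omega>}" if k: "k \<in> first_digits N" for k
  proof -
    have "prob {\<omega> \<in> space M. ?F k \<omega>} = expectation (indicator {\<omega> \<in> space M. ?F k \<omega>})"
      using F[OF k] by simp
    also have "\<dots> = expectation (\<lambda>\<omega>. of_bool (\<omega> (grid_cube N 1 k)) * of_bool (E (subtree N k \<omega>)))"
      by (intro Bochner_Integration.integral_cong) auto
    also have "\<dots> = p * expectation (\<lambda>\<omega>. of_bool (E \<omega>))"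
      by (rule expectation_child[OF k bounded_var_of_bool[OF E]])
    also have "expectation (\<lambda>\<omega>. of_bool (E \<omega>)) = expectation (indicator {\<omega> \<in> space M. E \<omega>})"
      by (intro Bochner_Integration.integral_cong) auto
    finally show ?thesis using prob_neg[OF F[OF k]] E by simp
  qed
  have "prob {\<omega> \<in> space M. \<forall>k\<in>first_digits N. \<not> ?F k \<omega>} = (\<Prod>k\<in>first_digits N. prob {\<omega> \<in> space M. \<not> ?F k \<omega>})"
  proof (rule prob_Ball[where K = "family N"])
    fix k :: "'d \<Rightarrow> nat" assume k: "k \<in> first_digits N"
    show "{\<omega> \<in> space M. \<not> ?F k \<omega>} \<in> sets M" using F[OF k] by (rule sets.sets_Collect_neg)
    show "depends_on (\<lambda>\<omega>. \<not> ?F k \<omega>) (family N k)" by (rule child_depends_on[where h = "\<lambda>a b. \<not> (a \<and> b)"])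
    show "family N k \<subseteq> all_cubes N" by (rule family_subset[OF N0 k])
  qed (rule finite_first_digits disjoint_family[OF N0])+
  also have "\<dots> = (\<Prod>k\<in>(first_digits N :: ('d \<Rightarrow> nat) set). 1 - p * prob {\<omega> \<in> space M. E \<omega>})"
    by (intro prod.cong refl p1)
  finally show "prob {\<omega> \<in> space M. \<forall>k\<in>first_digits N. \<not> ?F k \<omega>}
      = (1 - p * prob {\<omega> \<in> space M. E \<omega>}) ^ (N ^ CARD('d))"
    by (simp add: card_first_digits)
qed

text \<open>The retained cubes of level \<open>n\<close> are a function of finitely many states,
  which makes even topological properties of their union measurable.\<close>

lemma sets_retained:
  assumes "1 \<le> n"
  shows "{\<omega> \<in> space M. P (retained_cubes N \<omega> n)} \<in> sets M"
proof (rule sets_depends_on[where J = "\<Union>m\<in>{1..n}. level_cubes N m"])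
  show "depends_on (\<lambda>\<omega>. P (retained_cubes N \<omega> n)) (\<Union>m\<in>{1..n}. level_cubes N m)"
    using depends_on_retained_cubes[OF assms, of N] unfolding depends_on_def by metis
  show "finite (\<Union>m\<in>{1..n}. level_cubes N m)" by (simp add: finite_level_cubes)
  show "(\<Union>m\<in>{1..n}. level_cubes N m) \<subseteq> all_cubes N" unfolding all_cubes_def by auto
qed

lemma sets_extinct: "{\<omega> \<in> space M. extinct \<omega>} \<in> sets M"
proof -
  have "{\<omega> \<in> space M. extinct \<omega>} = (\<Union>n\<in>{1..}. {\<omega> \<in> space M. retained_cubes N \<omega> n = {}})"
    unfolding extinct_def by auto
  then show ?thesis using sets_retained[of _ "\<lambda>X. X = {}"] by auto
qed

lemma extinct_if_children_extinct:
  assumes "\<And>k. k \<in> children N \<omega> \<Longrightarrow> extinct (subtree N k \<omega>)"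
  shows "extinct \<omega>"
proof -
  have "\<forall>k\<in>children N \<omega>. \<exists>n\<ge>1. retained_cubes N (subtree N k \<omega>) n = {}" using assms unfolding extinct_def by blast
  then obtain n where n: "\<And>k. k \<in> children N \<omega> \<Longrightarrow> 1 \<le> n k" "\<And>k. k \<in> children N \<omega> \<Longrightarrow> retained_cubes N (subtree N k \<omega>) (n k) = {}"
    by metis
  \<comment> \<open>The maximum of finitely many extinction times; inserting 1 covers the case
    without children and keeps the level positive.\<close>
  define m where "m = Max (insert 1 (n ` children N \<omega>))"
  have fin: "finite (children N \<omega>)" unfolding children_def by (simp add: finite_first_digits)
  then have m: "1 \<le> m" "\<And>k. k \<in> children N \<omega> \<Longrightarrow> n k \<le> m" unfolding m_def by (auto intro!: Max_ge)
  have "retained_cubes N (subtree N k \<omega>) m = {}" if "k \<in> children N \<omega>" for k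
    using retained_cubes_empty_mono[OF N0 n(1) m(2) n(2)] that by blast
  then have "retained_cubes N \<omega> (Suc m) = {}" unfolding retained_cubes_Suc[OF N m(1)] by simp
  then show ?thesis unfolding extinct_def by (intro exI[of _ "Suc m"]) simp
qed

lemma limit_set_extinct: "extinct \<omega> \<Longrightarrow> limit_set N \<omega> = {}"
  unfolding extinct_def limit_set_def by blast

lemma marked_count_children:
  assumes "k \<in> children N \<omega>"
  shows "marked_count A n (subtree N k \<omega>) \<le> marked_count A (Suc n) \<omega>"
  unfolding card_marked_Suc[OF N0] branch_sum_def
  using assms by (intro member_le_sum) (auto simp: children_def finite_first_digits)

lemma fast_growth_child:
  assumes k: "k \<in> children N \<omega>" and "fast_growth A (subtree N k \<omega>)"
  shows "fast_growth A \<omega>"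
proof -
  obtain i where i: "\<forall>\<^sub>F n in sequentially. mean ^ n \<le> real (Suc i) * marked_count A n (subtree N k \<omega>)"
    using assms(2) unfolding fast_growth_def by blast
  \<comment> \<open>Passing from level \<open>n\<close> to \<open>Suc n\<close> costs one factor
    \<open>mean\<close>, which the larger constant absorbs.\<close>
  define j where "j = nat \<lceil>mean * real (Suc i)\<rceil>"
  have j: "mean * real (Suc i) \<le> real (Suc j)" unfolding j_def by linarith
  have "\<forall>\<^sub>F n in sequentially. mean ^ Suc n \<le> real (Suc j) * marked_count A (Suc n) \<omega>"
    using i
  proof eventually_elim
    case (elim n)
    have "mean ^ Suc n \<le> mean * (real (Suc i) * marked_count A n (subtree N k \<omega>))"
      using mult_left_mono[OF elim mean_nonneg] by simp
    also have "\<dots> \<le> real (Suc j) * marked_count A (Suc n) \<omega>"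
      unfolding mult.assoc[symmetric] using j marked_count_children[OF k] by (intro mult_mono) auto
    finally show ?case .
  qed
  then show ?thesis unfolding fast_growth_def eventually_sequentially_Suc[of "\<lambda>n. mean ^ n \<le> _ * marked_count A n \<omega>"] by blast
qed

context
  fixes A :: "((real ^ 'd) set \<Rightarrow> bool) \<Rightarrow> bool"
  assumes A: "{\<omega> \<in> space M. A \<omega>} \<in> sets M"
begin

section \<open>First and second moments of the marked counts\<close>

lemma bounded_var_marked_count: "bounded_var (marked_count A n)"
proof (induction n)
  case 0
  have "marked_count A 0 = (\<lambda>\<omega>. of_bool (A \<omega>))" by auto
  then show ?case using bounded_var_of_bool[OF A] by simp
next
  case (Suc n)
  then show ?case unfolding card_marked_Suc[OF N0, abs_def] by (rule bounded_var_branch_sum)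
qed

lemma expectation_marked_count: "expectation (marked_count A n) = mean ^ n * prob {\<omega> \<in> space M. A \<omega>}"
proof (induction n)
  case 0
  have "expectation (marked_count A 0) = expectation (indicator {\<omega> \<in> space M. A \<omega>})"
    by (intro Bochner_Integration.integral_cong) auto
  then show ?case using A by simp
next
  case (Suc n)
  then show ?case unfolding card_marked_Suc[OF N0, abs_def]
    by (simp add: expectation_branch_sum bounded_var_marked_count)
qed

lemma sets_fast_growth: "{\<omega> \<in> space M. fast_growth A \<omega>} \<in> sets M"
proof -
  have [measurable]: "marked_count A n \<in> borel_measurable M" for n
    using bounded_var_marked_count bounded_var_measurable by blast
  show ?thesis unfolding fast_growth_def eventually_sequentially by measurable
qed

text \<open>Divided by \<open>mean ^ Suc n\<close>, this is the increment of the normalised count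
  \<open>marked_count A n \<omega> / mean ^ n\<close>. It is centred and is itself propagated by
  \<open>branch_sum\<close>.\<close>

definition increment :: "nat \<Rightarrow> ((real ^ 'd) set \<Rightarrow> bool) \<Rightarrow> real" where
  "increment n \<omega> = marked_count A (Suc n) \<omega> - mean * marked_count A n \<omega>"

lemma bounded_var_increment: "bounded_var (increment n)"
  unfolding increment_def[abs_def] by (intro bounded_var_diff bounded_var_marked_count)

lemma increment_Suc: "increment (Suc n) = branch_sum N (increment n)"
  unfolding increment_def[abs_def] card_marked_Suc[OF N0] branch_sum_def
  by (auto simp: sum_subtractf sum_distrib_left)

lemma expectation_increment: "expectation (increment n) = 0"
  unfolding increment_def
  by (simp add: expectation_marked_count bounded_var_integrable bounded_var_marked_count)

lemma expectation_increment_square: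
  "expectation (\<lambda>\<omega>. (increment n \<omega>)\<^sup>2) = mean ^ n * expectation (\<lambda>\<omega>. (increment 0 \<omega>)\<^sup>2)"
proof (induction n)
  case (Suc n)
  then show ?case
    unfolding increment_Suc expectation_branch_sum_square[OF bounded_var_increment expectation_increment] by simp
qed simp

text \<open>The Cauchy--Schwarz inequality, in the form that the variance of
  \<open>\<bar>increment n \<omega>\<bar>\<close> is nonnegative.\<close>

lemma expectation_abs_increment:
  "expectation (\<lambda>\<omega>. \<bar>increment n \<omega>\<bar>) \<le> sqrt (expectation (\<lambda>\<omega>. (increment 0 \<omega>)\<^sup>2)) * sqrt mean ^ n"
proof -
  have sq: "integrable M (\<lambda>\<omega>. (increment n \<omega>)\<^sup>2)"
    using bounded_var_integrable[OF bounded_var_mult[OF bounded_var_increment bounded_var_increment]]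
    by (simp add: power2_eq_square)
  have "0 \<le> variance (\<lambda>\<omega>. \<bar>increment n \<omega>\<bar>)" by (rule variance_positive)
  also have "\<dots> = expectation (\<lambda>\<omega>. (increment n \<omega>)\<^sup>2) - (expectation (\<lambda>\<omega>. \<bar>increment n \<omega>\<bar>))\<^sup>2"
    using sq integrable_abs[OF bounded_var_integrable[OF bounded_var_increment]] by (subst variance_eq) auto
  finally have "(expectation (\<lambda>\<omega>. \<bar>increment n \<omega>\<bar>))\<^sup>2 \<le> mean ^ n * expectation (\<lambda>\<omega>. (increment 0 \<omega>)\<^sup>2)"
    unfolding expectation_increment_square[of n] by simp
  then have "expectation (\<lambda>\<omega>. \<bar>increment n \<omega>\<bar>) \<le> sqrt (mean ^ n * expectation (\<lambda>\<omega>. (increment 0 \<omega>)\<^sup>2))"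
    by (rule real_le_rsqrt)
  then show ?thesis by (simp add: real_sqrt_mult real_sqrt_power mult.commute)
qed

text \<open>
  The normalised counts \<open>marked_count A n / mean ^ n\<close> all have the same expectation and their
  increments have geometrically decaying first moments. Hence from some time on their total
  variation is in expectation too small to bring them down to \<open>0\<close> almost surely.
\<close>

lemma prob_fast_growth_pos:
  assumes mean: "1 < mean" and q: "0 < prob {\<omega> \<in> space M. A \<omega>}"
  shows "0 < prob {\<omega> \<in> space M. fast_growth A \<omega>}"
proof (rule ccontr)
  assume "\<not> 0 < prob {\<omega> \<in> space M. fast_growth A \<omega>}"
  then have "prob {\<omega> \<in> space M. fast_growth A \<omega>} = 0" using measure_nonneg[of M "{\<omega> \<in> space M. fast_growth A \<omega>}"] by linarith
  then have AE: "AE \<omega> in M. \<not> fast_growth A \<omega>"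
    using sets_fast_growth by (subst AE_iff_measurable[OF _ refl]) (auto simp: emeasure_eq_measure)
  define q where "q = prob {\<omega> \<in> space M. A \<omega>}"
  define W where "W n \<omega> = marked_count A n \<omega> / mean ^ n" for n \<omega>
  \<comment> \<open>Dividing the first-moment bound by \<open>mean ^ Suc n\<close> gives
    \<open>C * r ^ n\<close>, since \<open>sqrt mean ^ n / mean ^ n = r ^ n\<close>.\<close>
  define C where "C = sqrt (expectation (\<lambda>\<omega>. (increment 0 \<omega>)\<^sup>2)) / mean"
  define r where "r = 1 / sqrt mean"
  have r: "0 \<le> r" "r < 1" using mean by (auto simp: r_def)
  have C: "0 \<le> C" unfolding C_def using mean by (intro divide_nonneg_pos real_sqrt_ge_zero integral_nonneg) auto
  have W_meas [measurable]: "W n \<in> borel_measurable M" for n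
    unfolding W_def[abs_def] using bounded_var_measurable[OF bounded_var_marked_count[of n]] by simp
  have W_diff: "W (Suc n) \<omega> - W n \<omega> = increment n \<omega> / mean ^ Suc n" for n \<omega>
    unfolding W_def increment_def using mean by (simp add: field_simps)
  have W_step: "(\<integral>\<^sup>+\<omega>. ennreal \<bar>W (Suc n) \<omega> - W n \<omega>\<bar> \<partial>M) \<le> ennreal (C * r ^ n)" for n
  proof -
    have int: "integrable M (increment n)" by (rule bounded_var_integrable[OF bounded_var_increment])
    have "(\<integral>\<^sup>+\<omega>. ennreal \<bar>W (Suc n) \<omega> - W n \<omega>\<bar> \<partial>M) = (\<integral>\<^sup>+\<omega>. ennreal (\<bar>increment n \<omega>\<bar> / mean ^ Suc n) \<partial>M)"
      unfolding W_diff using mean by (simp add: abs_mult)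
    also have "\<dots> = ennreal (expectation (\<lambda>\<omega>. \<bar>increment n \<omega>\<bar>) / mean ^ Suc n)"
      using int mean by (subst nn_integral_eq_integral) auto
    also have "\<dots> \<le> ennreal (sqrt (expectation (\<lambda>\<omega>. (increment 0 \<omega>)\<^sup>2)) * sqrt mean ^ n / mean ^ Suc n)"
      using mean by (intro ennreal_leI divide_right_mono expectation_abs_increment) auto
    also have "sqrt mean ^ n / mean ^ Suc n = r ^ n / mean"
    proof -
      have "mean ^ n = sqrt mean ^ n * sqrt mean ^ n"
        using mean by (simp flip: power_mult_distrib)
      then show ?thesis using mean by (simp add: r_def power_divide)
    qed
    then have "sqrt (expectation (\<lambda>\<omega>. (increment 0 \<omega>)\<^sup>2)) * sqrt mean ^ n / mean ^ Suc n = C * r ^ n"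
      unfolding C_def by (simp add: mult.assoc flip: times_divide_eq_right)
    finally show ?thesis .
  qed
  have "(\<lambda>n. C * r ^ n / (1 - r)) \<longlonglongrightarrow> C * 0 / (1 - r)"
    using r by (intro tendsto_intros LIMSEQ_power_zero) auto
  then have "\<forall>\<^sub>F n in sequentially. C * r ^ n / (1 - r) < q / 4"
    using q by (intro order_tendstoD(2)) (auto simp: q_def)
  then obtain n where n: "C * r ^ n / (1 - r) < q / 4" by (meson eventually_sequentially order_refl)
  define U where "U \<omega> = (\<Sum>i. ennreal \<bar>W (n + Suc i) \<omega> - W (n + i) \<omega>\<bar>)" for \<omega>
  have "(\<integral>\<^sup>+\<omega>. U \<omega> \<partial>M) = (\<Sum>i. \<integral>\<^sup>+\<omega>. ennreal \<bar>W (n + Suc i) \<omega> - W (n + i) \<omega>\<bar> \<partial>M)"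
    unfolding U_def by (intro nn_integral_suminf) measurable
  also have "\<dots> \<le> (\<Sum>i. ennreal (C * r ^ n * r ^ i))"
    using W_step[of "n + _"] by (intro suminf_le) (auto simp: power_add mult.assoc)
  also have "\<dots> = ennreal (C * r ^ n / (1 - r))"
    using C r geometric_sums[of r, THEN sums_mult, of "C * r ^ n"]
    by (intro suminf_ennreal_eq) auto
  also have "\<dots> \<le> ennreal (q / 4)" using n by (intro ennreal_leI) auto
  finally have U: "(\<integral>\<^sup>+\<omega>. U \<omega> \<partial>M) \<le> ennreal (q / 4)" .
  \<comment> \<open>If the normalised count stayed at least \<open>q / 4\<close> from level
    \<open>n\<close> on, there would be fast growth with a constant of about \<open>4 / q\<close>.
    So it falls below \<open>q / 4\<close> at some point, and the variation \<open>U\<close> after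
    level \<open>n\<close> accounts for the rest of \<open>W n\<close>.\<close>
  have bound: "ennreal (W n \<omega>) \<le> U \<omega> + ennreal (q / 4)" if "\<not> fast_growth A \<omega>" for \<omega>
  proof (rule ccontr)
    assume less: "\<not> ennreal (W n \<omega>) \<le> U \<omega> + ennreal (q / 4)"
    have "W (n + j) \<omega> \<ge> q / 4" for j
    proof (rule ccontr)
      assume j: "\<not> q / 4 \<le> W (n + j) \<omega>"
      have "W n \<omega> - W (n + j) \<omega> = (\<Sum>i<j. W (n + i) \<omega> - W (n + Suc i) \<omega>)"
        using sum_lessThan_telescope'[of "\<lambda>i. W (n + i) \<omega>" j] by simp
      also have "\<dots> \<le> (\<Sum>i<j. \<bar>W (n + Suc i) \<omega> - W (n + i) \<omega>\<bar>)" by (intro sum_mono) auto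
      finally have "W n \<omega> \<le> (\<Sum>i<j. \<bar>W (n + Suc i) \<omega> - W (n + i) \<omega>\<bar>) + q / 4" using j by simp
      then have "ennreal (W n \<omega>) \<le> ennreal ((\<Sum>i<j. \<bar>W (n + Suc i) \<omega> - W (n + i) \<omega>\<bar>) + q / 4)"
        by (rule ennreal_leI)
      also have "\<dots> = (\<Sum>i<j. ennreal \<bar>W (n + Suc i) \<omega> - W (n + i) \<omega>\<bar>) + ennreal (q / 4)"
        using q by (subst ennreal_plus) (auto simp: q_def sum_nonneg)
      also have "\<dots> \<le> U \<omega> + ennreal (q / 4)"
        unfolding U_def by (intro add_right_mono sum_le_suminf) auto
      finally show False using less by simp
    qed
    then have "mean ^ k * (q / 4) \<le> marked_count A k \<omega>" if "k \<ge> n" for k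
      using le_Suc_ex[OF that] mean unfolding W_def by (auto simp: field_simps)
    moreover define i where "i = nat \<lceil>4 / q\<rceil>"
    have "4 / q \<le> real (Suc i)" unfolding i_def by linarith
    ultimately have "mean ^ k \<le> real (Suc i) * marked_count A k \<omega>" if "k \<ge> n" for k
    proof -
      have "mean ^ k = 4 / q * (mean ^ k * (q / 4))" using q by (simp add: q_def)
      also have "\<dots> \<le> real (Suc i) * marked_count A k \<omega>"
        using \<open>4 / q \<le> real (Suc i)\<close> \<open>\<And>k. n \<le> k \<Longrightarrow> mean ^ k * (q / 4) \<le> marked_count A k \<omega>\<close>[OF that] q mean
        by (intro mult_mono) (auto simp: q_def)
      finally show ?thesis .
    qed
    then have "fast_growth A \<omega>" unfolding fast_growth_def eventually_sequentially by blast
    then show False using that by simp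
  qed
  \<comment> \<open>\<open>W n\<close> has expectation \<open>q\<close>, so integrating the bound
    gives \<open>q \<le> q / 4 + q / 4\<close>.\<close>
  have "ennreal q = ennreal (expectation (W n))"
    unfolding W_def using mean by (simp add: expectation_marked_count q_def)
  also have "\<dots> = (\<integral>\<^sup>+\<omega>. ennreal (W n \<omega>) \<partial>M)"
    unfolding W_def using mean bounded_var_integrable[OF bounded_var_marked_count[of n]]
    by (intro nn_integral_eq_integral[symmetric]) auto
  also have "\<dots> \<le> (\<integral>\<^sup>+\<omega>. U \<omega> + ennreal (q / 4) \<partial>M)"
    by (rule nn_integral_mono_AE) (use AE bound in auto)
  also have "\<dots> = (\<integral>\<^sup>+\<omega>. U \<omega> \<partial>M) + ennreal (q / 4)"
    unfolding U_def by (subst nn_integral_add) (auto simp: emeasure_space_1)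
  also have "\<dots> \<le> ennreal (q / 4) + ennreal (q / 4)" using U by (intro add_right_mono)
  also have "\<dots> = ennreal (q / 2)" using q by (simp add: q_def flip: ennreal_plus)
  finally show False using q by (simp add: q_def)
qed

text \<open>Let \<open>s\<close> and \<open>g\<close> be the probabilities of survival and of fast
  growth. Growth below one child gives growth, so \<open>1 - g\<close> is at most the generating
  function there; extinction below all children gives extinction, so \<open>1 - s\<close> is at
  least the generating function there. Hence \<open>s \<le> g\<close>, and since extinction excludes
  growth, the two events together have full probability.\<close>

lemma AE_extinct_or_fast_growth:
  assumes mean: "1 < mean" and q: "0 < prob {\<omega> \<in> space M. A \<omega>}"
    and A_limit: "\<And>\<omega>. A \<omega> \<Longrightarrow> nontrivial_part (limit_set N \<omega>) \<noteq> {}"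
  shows "AE \<omega> in M. extinct \<omega> \<or> fast_growth A \<omega>"
proof -
  let ?G = "{\<omega> \<in> space M. fast_growth A \<omega>}" and ?X = "{\<omega> \<in> space M. extinct \<omega>}"
  let ?S = "{\<omega> \<in> space M. \<not> extinct \<omega>}"
  have S: "?S \<in> sets M" using sets_extinct by (rule sets.sets_Collect_neg)
  have "p \<noteq> 0" using mean unfolding mean_def by auto
  then have p_pos: "0 < p" using p by simp
  have negG: "prob {\<omega> \<in> space M. \<not> fast_growth A \<omega>} = 1 - prob ?G" by (rule prob_neg[OF sets_fast_growth])
  have X: "prob ?X = 1 - prob ?S"
    using prob_neg[OF sets_extinct] by simp
  have "1 - prob ?G \<le> (1 - p * prob ?G) ^ (N ^ CARD('d))"
    unfolding negG[symmetric] prob_children(2)[OF sets_fast_growth, symmetric]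
    by (intro finite_measure_mono prob_children(1) sets_fast_growth) (auto simp: children_def intro: fast_growth_child)
  moreover have "(1 - p * prob ?S) ^ (N ^ CARD('d)) \<le> 1 - prob ?S"
    unfolding X[symmetric] prob_children(2)[OF S, symmetric]
  proof (rule finite_measure_mono[OF _ sets_extinct])
    show "{\<omega> \<in> space M. \<forall>k\<in>first_digits N. \<not> (\<omega> (grid_cube N 1 k) \<and> \<not> extinct (subtree N k \<omega>))} \<subseteq> ?X"
      using extinct_if_children_extinct unfolding children_def by blast
  qed
  moreover have "2 \<le> N ^ CARD('d)"
    using N self_le_power[of N "CARD('d)"] by (simp add: order_trans)
  ultimately have SG: "prob ?S \<le> prob ?G"
    using generating_function_fixed_point_unique[OF p_pos _ prob_fast_growth_pos[OF mean q]] p by auto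
  \<comment> \<open>Upon extinction the limit set is empty, so no cube can be marked, while
    \<open>mean ^ n\<close> is positive.\<close>
  have "\<not> fast_growth A \<omega>" if "extinct \<omega>" for \<omega>
  proof
    assume "fast_growth A \<omega>"
    then obtain i n where "mean ^ n \<le> real (Suc i) * marked_count A n \<omega>"
      unfolding fast_growth_def eventually_sequentially by blast
    moreover have "marked N A n \<omega> = {}"
      using marked_meets_nontrivial[OF N A_limit, of A _ n \<omega>] limit_set_extinct[OF that]
      unfolding nontrivial_part_def by auto
    ultimately show False using mean by (simp add: not_less[symmetric])
  qed
  then have disj: "?X \<inter> ?G = {}" by auto
  have "prob (?X \<union> ?G) = prob ?X + prob ?G"
    using disj sets_extinct sets_fast_growth by (intro finite_measure_Union)
  then have "prob (?X \<union> ?G) = 1" using SG X prob_le_1[of "?X \<union> ?G"] by linarith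
  then have "AE \<omega> in M. \<omega> \<in> ?X \<union> ?G" using prob_eq_1[of "?X \<union> ?G"] sets_extinct sets_fast_growth by auto
  then show ?thesis by eventually_elim auto
qed

end

end

section \<open>Box dimensions from counts of grid cubes\<close>

lemma mem_axis_cube: "x \<in> axis_cube a \<delta> \<longleftrightarrow> (\<forall>j. a $ j \<le> x $ j \<and> x $ j \<le> a $ j + \<delta>)"
  by (simp add: axis_cube_def mem_box_cart)

lemma level_cube_subset_axis_cube:
  assumes N: "0 < N" and Q: "Q \<in> level_cubes N n" and \<delta>: "1 / real N ^ n \<le> \<delta>"
  shows "\<exists>a. Q \<subseteq> axis_cube a \<delta>"
proof -
  obtain k where k: "Q = grid_cube N n k" using Q by (rule level_cubesE)
  have "Q \<subseteq> axis_cube (\<chi> j. (real (k j) - 1) / real N ^ n) \<delta>"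
  proof
    fix x assume x: "x \<in> Q"
    have "(real (k j) - 1) / real N ^ n \<le> x $ j \<and> x $ j \<le> (real (k j) - 1) / real N ^ n + \<delta>" for j
    proof -
      have "(real (k j) - 1) / real N ^ n \<le> x $ j" "x $ j \<le> real (k j) / real N ^ n"
        using x N unfolding k by (auto simp: mem_grid_cube field_simps)
      then show ?thesis using \<delta> by (simp add: diff_divide_distrib)
    qed
    then show "x \<in> axis_cube (\<chi> j. (real (k j) - 1) / real N ^ n) \<delta>" by (simp add: mem_axis_cube)
  qed
  then show ?thesis by blast
qed

text \<open>In each coordinate the index lies between \<open>a $ j * real N ^ n\<close> and that
  value plus 2, which leaves at most three integers.\<close>

lemma card_cubes_meeting_axis_cube:
  fixes a :: "real ^ 'd::finite"
  assumes N: "0 < N" and \<delta>: "\<delta> * real N ^ n \<le> 1"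
  shows "card {Q \<in> level_cubes N n. Q \<inter> axis_cube a \<delta> \<noteq> {}} \<le> 3 ^ CARD('d)"
proof -
  \<comment> \<open>Truncation at 0 is harmless: for a negative value the index is still at least 0
    and at most 2.\<close>
  define b where "b j = nat \<lceil>a $ j * real N ^ n\<rceil>" for j
  let ?K = "PiE (UNIV :: 'd set) (\<lambda>j. {b j..b j + 2})"
  have fin: "finite ?K" by (intro finite_PiE) auto
  have "{Q \<in> level_cubes N n. Q \<inter> axis_cube a \<delta> \<noteq> {}} \<subseteq> grid_cube N n ` ?K"
  proof
    fix Q assume "Q \<in> {Q \<in> level_cubes N n. Q \<inter> axis_cube a \<delta> \<noteq> {}}"
    then obtain x where Q: "Q \<in> level_cubes N n" and x: "x \<in> Q" "x \<in> axis_cube a \<delta>" by auto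
    obtain k where k: "Q = grid_cube N n k" using Q by (rule level_cubesE)
    have "b j \<le> k j \<and> k j \<le> b j + 2" for j
    proof -
      have 1: "real (k j) - 1 \<le> x $ j * real N ^ n" "x $ j * real N ^ n \<le> real (k j)"
        using x(1) N unfolding k by (auto simp: mem_grid_cube)
      have "a $ j * real N ^ n \<le> x $ j * real N ^ n" "x $ j * real N ^ n \<le> (a $ j + \<delta>) * real N ^ n"
        using x(2) by (auto simp: mem_axis_cube intro!: mult_right_mono)
      then have "a $ j * real N ^ n \<le> real (k j)" "real (k j) \<le> a $ j * real N ^ n + 2"
        using 1 \<delta> by (auto simp: distrib_right)
      then show ?thesis unfolding b_def by linarith
    qed
    then show "Q \<in> grid_cube N n ` ?K" unfolding k by auto
  qed
  then have "card {Q \<in> level_cubes N n. Q \<inter> axis_cube a \<delta> \<noteq> {}} \<le> card (grid_cube N n ` ?K)"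
    using fin by (intro card_mono) auto
  also have "\<dots> \<le> card ?K" by (rule card_image_le[OF fin])
  also have "\<dots> = 3 ^ CARD('d)" by (simp add: card_PiE)
  finally show ?thesis .
qed

lemma covering_number_le:
  fixes F :: "(real ^ 'd::finite) set"
  assumes N: "0 < N" and V: "V \<subseteq> level_cubes N n" "F \<subseteq> \<Union>V" and \<delta>: "1 / real N ^ n \<le> \<delta>"
  shows "covering_number \<delta> F \<le> card V"
proof -
  have fin: "finite V" using V(1) finite_level_cubes by (rule finite_subset)
  have "\<forall>Q\<in>V. \<exists>a. Q \<subseteq> axis_cube a \<delta>" using level_cube_subset_axis_cube[OF N _ \<delta>] V(1) by blast
  then obtain a where a: "\<And>Q. Q \<in> V \<Longrightarrow> Q \<subseteq> axis_cube (a Q) \<delta>" by metis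
  have "\<Union>V \<subseteq> (\<Union>b\<in>a ` V. axis_cube b \<delta>)" by (rule Union_least) (use a in blast)
  then have "F \<subseteq> (\<Union>b\<in>a ` V. axis_cube b \<delta>)" using V(2) by simp
  then have "covering_number \<delta> F \<le> card (a ` V)"
    unfolding covering_number_def using fin by (intro Least_le exI[of _ "a ` V"] conjI) auto
  also have "\<dots> \<le> card V" by (rule card_image_le[OF fin])
  finally show ?thesis .
qed

lemma card_le_covering_number:
  fixes F :: "(real ^ 'd::finite) set"
  assumes N: "2 \<le> N" and F: "F \<subseteq> \<Union>(level_cubes N 0)" and \<delta>: "0 < \<delta>" "\<delta> * real N ^ n \<le> 1"
    and V: "V \<subseteq> level_cubes N n" "\<And>Q. Q \<in> V \<Longrightarrow> Q \<inter> F \<noteq> {}"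
  shows "card V \<le> covering_number \<delta> F * 3 ^ CARD('d)"
proof -
  have N0: "0 < N" using N by simp
  let ?P = "\<lambda>m. \<exists>A. finite A \<and> card A = m \<and> F \<subseteq> (\<Union>a\<in>A. axis_cube a \<delta>)"
  \<comment> \<open>\<open>LEAST\<close> is meaningful only if some finite cover exists; a fine
    enough grid provides one.\<close>
  have "\<exists>m. ?P m"
  proof -
    obtain r where "1 / \<delta> < real N ^ r" using real_arch_pow[of "real N" "1 / \<delta>"] N by auto
    then have r: "1 / real N ^ r \<le> \<delta>" using \<delta> N by (simp add: field_simps)
    have sub: "\<Union>(level_cubes N 0) \<subseteq> (\<Union>(level_cubes N r) :: (real ^ 'd) set)"
    proof
      fix x :: "real ^ 'd" assume "x \<in> \<Union>(level_cubes N 0)"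
      then obtain Q where "Q \<in> level_cubes N 0" "x \<in> Q" by blast
      then have x: "0 \<le> x $ j \<and> x $ j \<le> 1" for j by (rule level_cube_unit[OF N0])
      \<comment> \<open>A coordinate equal to 0 would be rounded to index 0, whereas grid indices
        start at 1.\<close>
      define k where "k j = max 1 (nat \<lceil>x $ j * real N ^ r\<rceil>)" for j
      have "real (k j) - 1 \<le> x $ j * real N ^ r \<and> x $ j * real N ^ r \<le> real (k j) \<and> k j \<le> N ^ r" for j
      proof -
        have 0: "0 \<le> x $ j * real N ^ r" using x by simp
        have 1: "x $ j * real N ^ r \<le> real (N ^ r)" using x[of j] by (simp add: mult_left_le_one_le)
        then have "\<lceil>x $ j * real N ^ r\<rceil> \<le> int (N ^ r)" by (simp only: ceiling_le_iff of_int_of_nat_eq)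
        then have "nat \<lceil>x $ j * real N ^ r\<rceil> \<le> N ^ r" by linarith
        moreover have "1 \<le> N ^ r" using N0 by simp
        ultimately show ?thesis unfolding k_def using 0 by linarith
      qed
      then have "x \<in> grid_cube N r k" "grid_cube N r k \<in> level_cubes N r"
        using N0 by (auto simp: mem_grid_cube k_def intro!: level_cubesI)
      then show "x \<in> \<Union>(level_cubes N r)" by blast
    qed
    have "\<forall>Q\<in>level_cubes N r. \<exists>a :: real ^ 'd. Q \<subseteq> axis_cube a \<delta>"
      using level_cube_subset_axis_cube[OF N0 _ r] by blast
    then obtain a :: "(real ^ 'd) set \<Rightarrow> real ^ 'd" where "\<And>Q. Q \<in> level_cubes N r \<Longrightarrow> Q \<subseteq> axis_cube (a Q) \<delta>" by metis
    then have "F \<subseteq> (\<Union>b\<in>a ` level_cubes N r. axis_cube b \<delta>)" by (intro order_trans[OF F] order_trans[OF sub]) blast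
    then show ?thesis
      by (intro exI[of _ "card (a ` level_cubes N r)"] exI[of _ "a ` level_cubes N r"] conjI
          finite_imageI finite_level_cubes refl)
  qed
  then have "?P (covering_number \<delta> F)" unfolding covering_number_def by (rule LeastI_ex)
  then obtain A where A: "finite A" "card A = covering_number \<delta> F" "F \<subseteq> (\<Union>a\<in>A. axis_cube a \<delta>)" by blast
  have "V \<subseteq> (\<Union>a\<in>A. {Q \<in> level_cubes N n. Q \<inter> axis_cube a \<delta> \<noteq> {}})"
  proof
    fix Q assume "Q \<in> V"
    then obtain x where "x \<in> Q" "x \<in> F" "Q \<in> level_cubes N n" using V by blast
    then show "Q \<in> (\<Union>a\<in>A. {Q \<in> level_cubes N n. Q \<inter> axis_cube a \<delta> \<noteq> {}})" using A(3) by blast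
  qed
  then have "card V \<le> card (\<Union>a\<in>A. {Q \<in> level_cubes N n. Q \<inter> axis_cube a \<delta> \<noteq> {}})"
    by (intro card_mono finite_UN_I A(1) finite_subset[OF Collect_restrict finite_level_cubes])
  also have "\<dots> \<le> (\<Sum>a\<in>A. card {Q \<in> level_cubes N n. Q \<inter> axis_cube a \<delta> \<noteq> {}})" by (rule card_UN_le[OF A(1)])
  also have "\<dots> \<le> (\<Sum>a\<in>A. 3 ^ CARD('d))" by (intro sum_mono card_cubes_meeting_axis_cube N0 \<delta>)
  finally show ?thesis using A(2) by simp
qed

section \<open>Dimension bounds from counts along the scales \<open>1 / N ^ n\<close>\<close>

lemma tendsto_over_minus_ln: "((\<lambda>\<delta>. a + b / - ln \<delta>) \<longlongrightarrow> a) (at_right (0::real))"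
proof -
  have "filterlim (\<lambda>\<delta>::real. - ln \<delta>) at_top (at_right 0)"
    using ln_at_0 by (simp add: filterlim_uminus_at_bot)
  then have "((\<lambda>\<delta>. b / - ln \<delta>) \<longlongrightarrow> 0) (at_right (0::real))"
    by (intro tendsto_divide_0[OF tendsto_const] filterlim_at_top_imp_at_infinity)
  then show ?thesis using tendsto_add[OF tendsto_const] by fastforce
qed

lemma eventually_small_ln: "\<forall>\<^sub>F \<delta> in at_right (0::real). \<delta> > 0 \<and> - ln \<delta> > B"
proof -
  have "filterlim (\<lambda>\<delta>::real. - ln \<delta>) at_top (at_right 0)"
    using ln_at_0 by (simp add: filterlim_uminus_at_bot)
  then have "\<forall>\<^sub>F \<delta> in at_right (0::real). - ln \<delta> > B" by (simp add: filterlim_at_top_dense)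
  then show ?thesis using eventually_at_right_less[of 0] by eventually_elim auto
qed

lemma upper_box_dim_le:
  fixes F :: "(real ^ 'd::finite) set"
  assumes N: "2 \<le> N" and s: "1 \<le> s"
    and V: "\<forall>\<^sub>F n in sequentially. \<exists>V\<subseteq>level_cubes N n. F \<subseteq> \<Union>V \<and> real (card V) \<le> s ^ n"
  shows "upper_box_dim F \<le> ereal (ln s / ln N)"
proof (cases "F = {}")
  case True
  then show ?thesis using N s by (simp add: upper_box_dim_def)
next
  case False
  have lnN: "0 < ln (real N)" using N by simp
  obtain n0 where n0: "\<And>n. n \<ge> n0 \<Longrightarrow> \<exists>V\<subseteq>level_cubes N n. F \<subseteq> \<Union>V \<and> real (card V) \<le> s ^ n"
    using V unfolding eventually_sequentially by blast
  have "\<forall>\<^sub>F \<delta> in at_right (0::real). ereal (ln (real (covering_number \<delta> F)) / - ln \<delta>) \<le> ereal (ln s / ln N + ln s / - ln \<delta>)"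
    using eventually_small_ln[of "real n0 * ln N"]
  proof eventually_elim
    case (elim \<delta>)
    define L where "L = - ln \<delta>"
    have L: "0 < L" unfolding L_def using elim lnN by (smt (verit) mult_nonneg_nonneg of_nat_0_le_iff)
    \<comment> \<open>The first level whose cubes have side at most \<open>\<delta>\<close>;
      rounding costs the summand \<open>ln s / L\<close>, which vanishes in the limit.\<close>
    define n where "n = nat \<lceil>L / ln N\<rceil>"
    have "real n0 < L / ln N" using elim unfolding L_def pos_less_divide_eq[OF lnN] by blast
    then have n: "n0 \<le> n" "L / ln N \<le> real n" "real n \<le> L / ln N + 1" unfolding n_def by linarith+
    have "L \<le> real n * ln N" using n(2) lnN by (simp add: pos_divide_le_eq)
    then have "ln (1 / real N ^ n) \<le> ln \<delta>" using N by (simp add: ln_div ln_realpow L_def)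
    then have "1 / real N ^ n \<le> \<delta>" using N elim by (subst (asm) ln_le_cancel_iff) auto
    moreover obtain W where "W \<subseteq> level_cubes N n" "F \<subseteq> \<Union>W" "real (card W) \<le> s ^ n" using n0[OF n(1)] by blast
    ultimately have cov: "real (covering_number \<delta> F) \<le> s ^ n"
      using covering_number_le[of N W n F \<delta>] N by linarith
    have "ln (real (covering_number \<delta> F)) \<le> real n * ln s"
    \<comment> \<open>\<open>ln 0\<close> is 0, so a covering number 0 satisfies the bound as
      well.\<close>
    proof (cases "covering_number \<delta> F = 0")
      case False
      then have "ln (real (covering_number \<delta> F)) \<le> ln (s ^ n)" using cov s by simp
      then show ?thesis using s by (simp add: ln_realpow)
    qed (use s in simp)
    also have "\<dots> \<le> (L / ln N + 1) * ln s" using n(3) s by (intro mult_right_mono) auto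
    finally have "ln (real (covering_number \<delta> F)) / L \<le> (L / ln N + 1) * ln s / L" using L by (intro divide_right_mono) auto
    also have "\<dots> = ln s / ln N + ln s / L" using L lnN by (simp add: field_simps)
    finally show ?case by (simp add: L_def)
  qed
  then have "upper_box_dim F \<le> Limsup (at_right 0) (\<lambda>\<delta>. ereal (ln s / ln N + ln s / - ln \<delta>))"
    unfolding upper_box_dim_def using False by (simp add: Limsup_mono)
  also have "\<dots> = ereal (ln s / ln N)"
    using tendsto_over_minus_ln by (intro lim_imp_Limsup) auto
  finally show ?thesis .
qed

text \<open>Borel--Cantelli yields only rates strictly above the growth rate; continuity of
  \<open>ln\<close> removes the loss.\<close>

lemma upper_box_dim_le_limit:
  fixes F :: "(real ^ 'd::finite) set"
  assumes N: "2 \<le> N" and r: "1 \<le> r"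
    and V: "\<And>i. \<forall>\<^sub>F n in sequentially. \<exists>V\<subseteq>level_cubes N n. F \<subseteq> \<Union>V \<and> real (card V) \<le> (r + inverse (real (Suc i))) ^ n"
  shows "upper_box_dim F \<le> ereal (ln r / ln N)"
proof -
  have "(\<lambda>i. ln (r + inverse (real (Suc i))) / ln N) \<longlonglongrightarrow> ln (r + 0) / ln N"
    using r N by (intro tendsto_intros LIMSEQ_inverse_real_of_nat) auto
  then have lim: "(\<lambda>i. ereal (ln (r + inverse (real (Suc i))) / ln N)) \<longlonglongrightarrow> ereal (ln r / ln N)" by simp
  moreover have "upper_box_dim F \<le> ereal (ln (r + inverse (real (Suc i))) / ln N)" for i
    using r by (intro upper_box_dim_le N V) (simp add: add_increasing2)
  ultimately show ?thesis using LIMSEQ_le_const[OF lim] by blast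
qed

lemma lower_box_dim_ge:
  fixes F :: "(real ^ 'd::finite) set"
  assumes N: "2 \<le> N" and m: "1 < m" and c: "0 < c" and F: "F \<noteq> {}" "F \<subseteq> \<Union>(level_cubes N 0)"
    and V: "\<forall>\<^sub>F n in sequentially. \<exists>V\<subseteq>level_cubes N n. (\<forall>Q\<in>V. Q \<inter> F \<noteq> {}) \<and> c * m ^ n \<le> real (card V)"
  shows "ereal (ln m / ln N) \<le> lower_box_dim F"
proof -
  have lnN: "0 < ln (real N)" using N by simp
  obtain n0 where n0: "\<And>n. n \<ge> n0 \<Longrightarrow> \<exists>V\<subseteq>level_cubes N n. (\<forall>Q\<in>V. Q \<inter> F \<noteq> {}) \<and> c * m ^ n \<le> real (card V)"
    using V unfolding eventually_sequentially by blast
  \<comment> \<open>The bounded losses: the constant \<open>c\<close>, one level of rounding, and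
    the \<open>3 ^ CARD('d)\<close> grid cubes that a covering cube may meet.\<close>
  define K where "K = ln c - ln m - real CARD('d) * ln 3"
  have "\<forall>\<^sub>F \<delta> in at_right (0::real). ereal (ln m / ln N + K / - ln \<delta>) \<le> ereal (ln (real (covering_number \<delta> F)) / - ln \<delta>)"
    using eventually_small_ln[of "real (Suc n0) * ln N"]
  proof eventually_elim
    case (elim \<delta>)
    define L where "L = - ln \<delta>"
    have L: "0 < L" unfolding L_def using elim lnN by (smt (verit) mult_nonneg_nonneg of_nat_0_le_iff)
    \<comment> \<open>The last level whose cubes have side at least \<open>\<delta>\<close>; the
      margin \<open>Suc n0\<close> above keeps \<open>n0 \<le> n\<close> after rounding
      down.\<close>
    define n where "n = nat \<lfloor>L / ln N\<rfloor>"
    have "real (Suc n0) < L / ln N" using elim unfolding L_def pos_less_divide_eq[OF lnN] by blast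
    then have n: "n0 \<le> n" "real n \<le> L / ln N" "L / ln N - 1 \<le> real n" unfolding n_def by linarith+
    have "real n * ln N \<le> L" using n(2) lnN by (simp add: pos_le_divide_eq)
    then have "ln (\<delta> * real N ^ n) \<le> ln 1" using N elim by (simp add: ln_mult ln_realpow L_def)
    then have \<delta>: "\<delta> * real N ^ n \<le> 1" using N elim by (subst (asm) ln_le_cancel_iff) auto
    obtain W where W: "W \<subseteq> level_cubes N n" "\<And>Q. Q \<in> W \<Longrightarrow> Q \<inter> F \<noteq> {}" "c * m ^ n \<le> real (card W)"
      using n0[OF n(1)] by blast
    have "card W \<le> covering_number \<delta> F * 3 ^ CARD('d)"
      by (rule card_le_covering_number[OF N F(2) _ \<delta> W(1,2)]) (use elim in auto)
    then have cov: "c * m ^ n \<le> real (covering_number \<delta> F) * 3 ^ CARD('d)"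
      using W(3) by (metis (mono_tags) of_nat_le_iff of_nat_mult of_nat_numeral of_nat_power order_trans)
    have cm: "0 < c * m ^ n" using c m by simp
    then have "0 < real (covering_number \<delta> F)" using cov
      by (smt (verit) mult_nonpos_nonneg zero_le_power)
    then have "ln (c * m ^ n) \<le> ln (real (covering_number \<delta> F)) + real CARD('d) * ln 3"
      using cov cm ln_le_cancel_iff[OF cm, of "real (covering_number \<delta> F) * 3 ^ CARD('d)"]
      by (simp add: ln_mult ln_realpow)
    moreover have "ln (c * m ^ n) = ln c + real n * ln m" using c m by (simp add: ln_mult ln_realpow)
    moreover have "(L / ln N - 1) * ln m \<le> real n * ln m" using n(3) m by (intro mult_right_mono) auto
    ultimately have "L / ln N * ln m + K \<le> ln (real (covering_number \<delta> F))"
      unfolding K_def by (simp add: left_diff_distrib)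
    then have "(L / ln N * ln m + K) / L \<le> ln (real (covering_number \<delta> F)) / L" using L by (intro divide_right_mono) auto
    moreover have "(L / ln N * ln m + K) / L = ln m / ln N + K / L" using L lnN by (simp add: field_simps)
    ultimately show ?case by (simp add: L_def)
  qed
  then have "Liminf (at_right 0) (\<lambda>\<delta>. ereal (ln m / ln N + K / - ln \<delta>)) \<le> lower_box_dim F"
    unfolding lower_box_dim_def using F by (simp add: Liminf_mono)
  moreover have "Liminf (at_right 0) (\<lambda>\<delta>. ereal (ln m / ln N + K / - ln \<delta>)) = ereal (ln m / ln N)"
    using tendsto_over_minus_ln by (intro lim_imp_Liminf) auto
  ultimately show ?thesis by simp
qed

lemma lower_le_upper_box_dim: "lower_box_dim F \<le> upper_box_dim F"
  unfolding lower_box_dim_def upper_box_dim_def by (simp add: Liminf_le_Limsup)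

lemma box_dim_eqI:
  assumes "s \<le> lower_box_dim F" "upper_box_dim F \<le> s"
  shows "box_dim F = s"
proof -
  have "lower_box_dim F = s" "upper_box_dim F = s"
    using assms lower_le_upper_box_dim[of F] by auto
  then show ?thesis unfolding box_dim_def by auto
qed

section \<open>Cubes with an open neighbour at every scale\<close>

definition neighbours :: "nat \<Rightarrow> nat \<Rightarrow> (real ^ 'd) set \<Rightarrow> (real ^ 'd) set set" where
  "neighbours N n Q = {R \<in> level_cubes N n. R \<noteq> Q \<and> R \<inter> Q \<noteq> {}}"

text \<open>The neighbours need only be open themselves, not retained: then the condition at level
  \<open>j\<close> reads level-\<open>j\<close> cubes only. For \<open>i = Suc n\<close> it is empty
  and all retained cubes remain.\<close>

definition crossing_cubes :: "nat \<Rightarrow> ((real ^ 'd) set \<Rightarrow> bool) \<Rightarrow> nat \<Rightarrow> nat \<Rightarrow> (real ^ 'd) set set" where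
  "crossing_cubes N \<omega> i n = {Q \<in> retained_cubes N \<omega> n.
     \<forall>j\<in>{i..n}. \<forall>R\<in>level_cubes N j. Q \<subseteq> R \<longrightarrow> (\<exists>S\<in>neighbours N j R. \<omega> S)}"

lemma card_neighbours:
  fixes Q :: "(real ^ 'd::finite) set"
  assumes N: "0 < N" and Q: "Q \<in> level_cubes N n"
  shows "card (neighbours N n Q) \<le> 3 ^ CARD('d)"
proof -
  obtain a where a: "Q \<subseteq> axis_cube a (1 / real N ^ n)"
    using level_cube_subset_axis_cube[OF N Q order_refl] by blast
  have "neighbours N n Q \<subseteq> {R \<in> level_cubes N n. R \<inter> axis_cube a (1 / real N ^ n) \<noteq> {}}"
    using a unfolding neighbours_def by blast
  then have "card (neighbours N n Q) \<le> card {R \<in> level_cubes N n. R \<inter> axis_cube a (1 / real N ^ n) \<noteq> {}}"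
    by (intro card_mono finite_subset[OF Collect_restrict finite_level_cubes])
  also have "\<dots> \<le> 3 ^ CARD('d)" using N by (intro card_cubes_meeting_axis_cube) auto
  finally show ?thesis .
qed

lemma neighbours_subset: "neighbours N n Q \<subseteq> level_cubes N n"
  unfolding neighbours_def by auto

text \<open>
  If all neighbours of a level-\<open>j\<close> cube are off, the part of the limit set inside this cube is
  separated from the rest, so its components have diameter at most that of the cube.
\<close>

lemma large_part_subset_crossing_cubes:
  fixes \<omega> :: "(real ^ 'd::finite) set \<Rightarrow> bool"
  assumes N: "0 < N" and i: "1 \<le> i" "real CARD('d) / real N ^ i < \<epsilon>" and n: "1 \<le> n"
  shows "large_part \<epsilon> (limit_set N \<omega>) \<subseteq> \<Union>(crossing_cubes N \<omega> i n)"
proof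
  fix x assume "x \<in> large_part \<epsilon> (limit_set N \<omega>)"
  then obtain K where K: "K \<in> components (limit_set N \<omega>)" "\<epsilon> \<le> diameter K" "x \<in> K"
    unfolding large_part_def by auto
  have Ksub: "K \<subseteq> limit_set N \<omega>" using in_components_subset[OF K(1)] .
  then have "x \<in> approx_set N \<omega> n" using K(3) limit_set_subset[OF n] by blast
  then obtain Q where Q: "Q \<in> retained_cubes N \<omega> n" "x \<in> Q" unfolding approx_set_def by auto
  have "\<exists>S\<in>neighbours N j R. \<omega> S" if j: "j \<in> {i..n}" and R: "R \<in> level_cubes N j" "Q \<subseteq> R" for j R
  proof (rule ccontr)
    assume off: "\<not> (\<exists>S\<in>neighbours N j R. \<omega> S)"
    let ?U = "\<Union>(retained_cubes N \<omega> j - {R})"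
    have j1: "1 \<le> j" using j i by simp
    have cubes: "compact S" if "S \<in> level_cubes N j" for S :: "(real ^ 'd) set"
      by (rule level_cube_props(1)[OF N that])
    have R_closed: "closed R" using cubes[OF R(1)] by (rule compact_imp_closed)
    have U_closed: "closed ?U"
      using retained_cubes_level cubes
      by (intro compact_imp_closed compact_Union finite_Diff finite_retained_cubes) blast
    have "S \<inter> R = {}" if "S \<in> retained_cubes N \<omega> j - {R}" for S
    proof -
      have "S \<in> level_cubes N j" "\<omega> S" "S \<noteq> R" using that by (auto simp: retained_cubes_def)
      then show ?thesis using off unfolding neighbours_def by blast
    qed
    then have disj: "R \<inter> ?U = {}" by blast
    have cover: "K \<subseteq> R \<union> ?U"
      using Ksub limit_set_subset[OF j1, of N \<omega>] unfolding approx_set_def by blast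
    have "connected K" using in_components_connected[OF K(1)] .
    then have "R \<inter> K = {} \<or> ?U \<inter> K = {}"
      using connected_closedD[of K R ?U] R_closed U_closed cover disj by blast
    then have "K \<subseteq> R" using K(3) Q(2) R(2) cover by blast
    then have "diameter K \<le> diameter R"
      using cubes[OF R(1)] by (intro diameter_subset compact_imp_bounded)
    also have "\<dots> \<le> real CARD('d) / real N ^ j" by (rule diameter_level_cube[OF N R(1)])
    also have "\<dots> \<le> real CARD('d) / real N ^ i"
      using j N by (intro divide_left_mono power_increasing mult_pos_pos) auto
    finally show False using K(2) i by simp
  qed
  then have "Q \<in> crossing_cubes N \<omega> i n" using Q(1) unfolding crossing_cubes_def by blast
  then show "x \<in> \<Union>(crossing_cubes N \<omega> i n)" using Q(2) by blast
qed

lemma nontrivial_part_large_part: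
  assumes "bounded S" "nontrivial_part S \<noteq> {}"
  shows "\<exists>i. large_part (inverse (real (Suc i))) S \<noteq> {}"
proof -
  obtain x y where xy: "y \<noteq> x" "connected_component S x y" using assms(2) by (auto simp: nontrivial_part_iff)
  obtain i where i: "inverse (real (Suc i)) < dist x y" using reals_Archimedean[of "dist x y"] xy(1) by auto
  let ?K = "connected_component_set S x"
  have xS: "x \<in> S" using connected_component_in[OF xy(2)] by simp
  have "bounded ?K" using bounded_subset[OF assms(1) connected_component_subset] .
  then have "dist x y \<le> diameter ?K"
    using xy(2) xS by (intro diameter_bounded_bound) auto
  then have "?K \<in> {K \<in> components S. inverse (real (Suc i)) \<le> diameter K}"
    using i xS by (auto simp: componentsI)
  moreover have "x \<in> ?K" using xS by simp
  ultimately have "x \<in> large_part (inverse (real (Suc i))) S" unfolding large_part_def by blast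
  then show ?thesis by blast
qed

context fractal_percolation
begin

lemma prob_conj:
  assumes "{\<omega> \<in> space M. E \<omega>} \<in> sets M" "{\<omega> \<in> space M. F \<omega>} \<in> sets M"
    and "depends_on E K" "depends_on F K'" "K \<subseteq> all_cubes N" "K' \<subseteq> all_cubes N" "K \<inter> K' = {}"
  shows "prob {\<omega> \<in> space M. E \<omega> \<and> F \<omega>} = prob {\<omega> \<in> space M. E \<omega>} * prob {\<omega> \<in> space M. F \<omega>}"
proof -
  have "prob {\<omega> \<in> space M. \<forall>b\<in>UNIV. (if b then E else F) \<omega>}
      = (\<Prod>b\<in>UNIV. prob {\<omega> \<in> space M. (if b then E else F) \<omega>})"
    using assms by (intro prob_Ball[where K = "\<lambda>b. if b then K else K'"])
      (auto simp: disjoint_family_on_def)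
  moreover have "{\<omega> \<in> space M. \<forall>b\<in>UNIV. (if b then E else F) \<omega>} = {\<omega> \<in> space M. E \<omega> \<and> F \<omega>}"
    by (auto split: if_splits)
  ultimately show ?thesis by (simp add: UNIV_bool mult.commute)
qed

text \<open>Halving the probability of no open neighbour keeps the factor positive even for \<open>p = 0\<close>.\<close>

definition crossing_factor :: real where
  "crossing_factor = 1 - (1 - p) ^ (3 ^ CARD('d)) / 2"

lemma crossing_factor: "0 < crossing_factor" "crossing_factor < 1"
proof -
  have "0 < (1 - p) ^ (3 ^ CARD('d))" "(1 - p) ^ (3 ^ CARD('d)) \<le> 1"
    using p by (auto intro!: zero_less_power power_le_one)
  then show "0 < crossing_factor" "crossing_factor < 1" unfolding crossing_factor_def by linarith+
qed

lemma sets_depends_on_level: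
  assumes "depends_on P (level_cubes N n)" "1 \<le> n"
  shows "{\<omega> \<in> space M. P \<omega>} \<in> sets M"
  using assms level_cubes_subset_all[of n N]
  by (intro sets_depends_on[where J = "level_cubes N n"] finite_level_cubes)

text \<open>\<open>neighbours\<close> omits \<open>Q\<close>, so the state of \<open>Q\<close> is
  independent of theirs, and their number is at most \<open>3 ^ CARD('d)\<close>.\<close>

lemma prob_open_neighbour:
  assumes n: "1 \<le> n" and Q: "Q \<in> level_cubes N n"
  shows "prob {\<omega> \<in> space M. \<omega> Q \<and> (\<exists>S\<in>neighbours N n Q. \<omega> S)} \<le> p * crossing_factor"
proof -
  let ?J = "neighbours N n Q"
  have J: "finite ?J" "?J \<subseteq> all_cubes N"
    using finite_subset[OF neighbours_subset finite_level_cubes] neighbours_subset level_cubes_subset_all[OF n] by blast+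
  have Q': "Q \<in> all_cubes N" using Q level_cubes_subset_all[OF n] by blast
  have sJ: "{\<omega> \<in> space M. \<exists>S\<in>?J. \<omega> S} \<in> sets M"
    by (rule sets_depends_on[OF _ J]) (auto simp: depends_on_def)
  have sQ: "{\<omega> \<in> space M. \<omega> Q} \<in> sets M" using measurable_cube[OF Q'] by (simp add: pred_def)
  have "prob {\<omega> \<in> space M. \<omega> Q \<and> (\<exists>S\<in>?J. \<omega> S)} = prob {\<omega> \<in> space M. \<omega> Q} * prob {\<omega> \<in> space M. \<exists>S\<in>?J. \<omega> S}"
    by (rule prob_conj[OF sQ sJ, of "{Q}" ?J])
       (use J Q' in \<open>auto simp: depends_on_def neighbours_def\<close>)
  also have "prob {\<omega> \<in> space M. \<omega> Q} = p" by (rule prob_cube[OF Q'])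
  also have "prob {\<omega> \<in> space M. \<exists>S\<in>?J. \<omega> S} = 1 - (1 - p) ^ card ?J"
    using prob_neg[OF sJ] prob_all_cubes_off[OF J] by simp
  also have "p * \<dots> \<le> p * crossing_factor"
  proof -
    have "(1 - p) ^ (3 ^ CARD('d)) \<le> (1 - p) ^ card ?J"
      using p card_neighbours[OF N0 Q] by (intro power_decreasing) auto
    moreover have "0 \<le> (1 - p) ^ (3 ^ CARD('d))" using p by simp
    ultimately have "1 - (1 - p) ^ card ?J \<le> crossing_factor" unfolding crossing_factor_def by linarith
    then show ?thesis using p by (intro mult_left_mono) auto
  qed
  finally show ?thesis .
qed

lemma sets_crossing:
  assumes n: "1 \<le> n" and i: "1 \<le> i"
  shows "{\<omega> \<in> space M. Q \<in> crossing_cubes N \<omega> i n} \<in> sets M"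
proof (rule sets_depends_on[where J = "\<Union>m\<in>{1..n}. level_cubes N m"])
  show "depends_on (\<lambda>\<omega>. Q \<in> crossing_cubes N \<omega> i n) (\<Union>m\<in>{1..n}. level_cubes N m)"
  proof (rule depends_onI)
    fix \<omega> \<omega>' :: "(real ^ 'd) set \<Rightarrow> bool"
    assume eq: "\<And>Q. Q \<in> (\<Union>m\<in>{1..n}. level_cubes N m) \<Longrightarrow> \<omega> Q = \<omega>' Q"
    have "retained_cubes N \<omega> n = retained_cubes N \<omega>' n"
      by (rule depends_onD[OF depends_on_retained_cubes[OF n] eq])
    moreover have "(\<exists>S\<in>neighbours N j R. \<omega> S) = (\<exists>S\<in>neighbours N j R. \<omega>' S)" if "j \<in> {i..n}" for j R
    proof (intro bex_cong refl eq UN_I[of j])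
      show "j \<in> {1..n}" using that i by simp
      show "S \<in> level_cubes N j" if "S \<in> neighbours N j R" for S using that neighbours_subset by blast
    qed
    ultimately show "(Q \<in> crossing_cubes N \<omega> i n) = (Q \<in> crossing_cubes N \<omega>' i n)"
      unfolding crossing_cubes_def by simp
  qed
  show "finite (\<Union>m\<in>{1..n}. level_cubes N m)" by (simp add: finite_level_cubes)
  show "(\<Union>m\<in>{1..n}. level_cubes N m) \<subseteq> all_cubes N" unfolding all_cubes_def by auto
qed

text \<open>The conditions on the ancestors \<open>R j\<close> read disjoint sets of coordinates.
  Each of the \<open>n\<close> levels contributes \<open>p\<close>, and each of the
  \<open>Suc n - i\<close> levels from \<open>i\<close> on also
  \<open>crossing_factor\<close>.\<close>

lemma prob_crossing:
  assumes n: "1 \<le> n" and i: "1 \<le> i" "i \<le> Suc n" and Q: "Q \<in> level_cubes N n"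
  shows "prob {\<omega> \<in> space M. Q \<in> crossing_cubes N \<omega> i n} \<le> p ^ n * crossing_factor ^ (Suc n - i)"
proof -
  have "\<forall>j\<in>{1..n}. \<exists>R\<in>level_cubes N j. Q \<subseteq> R"
    using level_cube_ancestor[OF N0 Q] by (metis atLeastAtMost_iff)
  then obtain R where R: "\<And>j. j \<in> {1..n} \<Longrightarrow> R j \<in> level_cubes N j" "\<And>j. j \<in> {1..n} \<Longrightarrow> Q \<subseteq> R j"
    by metis
  let ?E = "\<lambda>j \<omega>. \<omega> (R j) \<and> (i \<le> j \<longrightarrow> (\<exists>S\<in>neighbours N j (R j). \<omega> S))"
  have dep: "depends_on (?E j) (level_cubes N j)" if "j \<in> {1..n}" for j
  proof (rule depends_onI)
    fix \<omega> \<omega>' :: "(real ^ 'd) set \<Rightarrow> bool"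
    assume eq: "\<And>Q. Q \<in> level_cubes N j \<Longrightarrow> \<omega> Q = \<omega>' Q"
    have "(\<exists>S\<in>neighbours N j (R j). \<omega> S) = (\<exists>S\<in>neighbours N j (R j). \<omega>' S)"
      using neighbours_subset by (intro bex_cong refl eq) blast
    then show "?E j \<omega> = ?E j \<omega>'" using eq[OF R(1)[OF that]] by simp
  qed
  have meas: "{\<omega> \<in> space M. ?E j \<omega>} \<in> sets M" if "j \<in> {1..n}" for j
    using sets_depends_on_level[OF dep[OF that]] that by simp
  \<comment> \<open>\<open>retained_cubes\<close> treats \<open>Q\<close> apart from its proper
    ancestors, so level \<open>n\<close> needs this identification.\<close>
  have "Q = R n"
  proof -
    obtain k k' where k: "Q = grid_cube N n k" "R n = grid_cube N n k'"
      using Q R(1)[of n] n by (metis atLeastAtMost_iff level_cubesE order_refl)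
    then show ?thesis using grid_cube_subset_unique[OF N0, of n k n k k'] R(2)[of n] n by simp
  qed
  then have "{\<omega> \<in> space M. Q \<in> crossing_cubes N \<omega> i n} \<subseteq> {\<omega> \<in> space M. \<forall>j\<in>{1..n}. ?E j \<omega>}"
  proof (intro subsetI CollectI conjI ballI impI, goal_cases)
    case (1 \<omega>)
    then show ?case by simp
  next
    case (2 \<omega> j)
    then have ret: "Q \<in> retained_cubes N \<omega> n" by (simp add: crossing_cubes_def)
    show ?case
    proof (cases "j = n")
      case True
      then show ?thesis using ret 2(1) by (simp add: retained_cubes_def)
    next
      case False
      then have "j \<in> {1..<n}" using 2(3) by auto
      then show ?thesis using ret R[OF 2(3)] unfolding retained_cubes_def by blast
    qed
  next
    case (3 \<omega> j)
    then have "j \<in> {i..n}" by simp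
    then show ?case using 3(2) R[OF 3(3)] unfolding crossing_cubes_def by blast
  qed
  moreover have meas_all: "{\<omega> \<in> space M. \<forall>j\<in>{1..n}. ?E j \<omega>} \<in> sets M"
    by (intro sets.sets_Collect_finite_All meas) auto
  ultimately have "prob {\<omega> \<in> space M. Q \<in> crossing_cubes N \<omega> i n} \<le> prob {\<omega> \<in> space M. \<forall>j\<in>{1..n}. ?E j \<omega>}"
    by (rule finite_measure_mono)
  also have "\<dots> = (\<Prod>j\<in>{1..n}. prob {\<omega> \<in> space M. ?E j \<omega>})"
  proof (rule prob_Ball[where K = "level_cubes N"])
    show "disjoint_family_on (level_cubes N) {1..n}"
      unfolding disjoint_family_on_def using level_cubes_disjoint[OF N] by blast
    show "level_cubes N j \<subseteq> all_cubes N" if "j \<in> {1..n}" for j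
      using that by (intro level_cubes_subset_all) simp
  qed (use dep meas in auto)
  also have "\<dots> \<le> (\<Prod>j\<in>{1..n}. p * (if i \<le> j then crossing_factor else 1))"
  proof (intro prod_mono conjI measure_nonneg)
    fix j assume j: "j \<in> {1..n}"
    have Rj: "R j \<in> all_cubes N" using R(1)[OF j] level_cubes_subset_all[of j N] j by auto
    show "prob {\<omega> \<in> space M. ?E j \<omega>} \<le> p * (if i \<le> j then crossing_factor else 1)"
      using prob_open_neighbour[OF _ R(1)[OF j]] prob_cube[OF Rj] j by auto
  qed
  also have "\<dots> = p ^ n * (\<Prod>j\<in>{1..n}. if i \<le> j then crossing_factor else 1)"
    by (simp add: prod.distrib)
  also have "(\<Prod>j\<in>{1..n}. if i \<le> j then crossing_factor else 1) = (\<Prod>j\<in>{j \<in> {1..n}. i \<le> j}. crossing_factor)"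
    by (rule prod.inter_filter[symmetric]) simp
  also have "{j \<in> {1..n}. i \<le> j} = {i..n}" using i by auto
  finally show ?thesis by simp
qed

lemma expectation_card_crossing:
  assumes n: "1 \<le> n" and i: "1 \<le> i" "i \<le> Suc n"
  shows "integrable M (\<lambda>\<omega>. real (card (crossing_cubes N \<omega> i n)))" (is ?int)
    and "expectation (\<lambda>\<omega>. real (card (crossing_cubes N \<omega> i n))) \<le> mean ^ n * crossing_factor ^ (Suc n - i)" (is ?le)
proof -
  let ?L = "level_cubes N n :: (real ^ 'd) set set"
  have eq: "real (card (crossing_cubes N \<omega> i n)) = (\<Sum>Q\<in>?L. of_bool (Q \<in> crossing_cubes N \<omega> i n))" for \<omega>
  proof -
    have "(\<Sum>Q\<in>?L. of_bool (Q \<in> crossing_cubes N \<omega> i n) :: real) = real (card (?L \<inter> {Q. Q \<in> crossing_cubes N \<omega> i n}))"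
      by (simp add: finite_level_cubes)
    also have "?L \<inter> {Q. Q \<in> crossing_cubes N \<omega> i n} = crossing_cubes N \<omega> i n"
      unfolding crossing_cubes_def retained_cubes_def by auto
    finally show ?thesis by simp
  qed
  have bv: "bounded_var (\<lambda>\<omega>. of_bool (Q \<in> crossing_cubes N \<omega> i n))" for Q
    by (rule bounded_var_of_bool[OF sets_crossing[OF n i(1)]])
  show ?int unfolding eq by (intro bounded_var_integrable bounded_var_sum finite_level_cubes bv)
  have "expectation (\<lambda>\<omega>. real (card (crossing_cubes N \<omega> i n)))
      = (\<Sum>Q\<in>?L. expectation (\<lambda>\<omega>. of_bool (Q \<in> crossing_cubes N \<omega> i n)))"
    unfolding eq by (intro Bochner_Integration.integral_sum bounded_var_integrable bv)
  also have "\<dots> = (\<Sum>Q\<in>?L. expectation (indicator {\<omega> \<in> space M. Q \<in> crossing_cubes N \<omega> i n}))"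
    by (intro sum.cong refl Bochner_Integration.integral_cong) auto
  also have "\<dots> = (\<Sum>Q\<in>?L. prob {\<omega> \<in> space M. Q \<in> crossing_cubes N \<omega> i n})"
    using sets_crossing[OF n i(1)] by simp
  also have "\<dots> \<le> (\<Sum>Q\<in>?L. p ^ n * crossing_factor ^ (Suc n - i))"
    by (intro sum_mono prob_crossing n i)
  also have "\<dots> = real (card ?L) * (p ^ n * crossing_factor ^ (Suc n - i))" by simp
  also have "\<dots> \<le> real ((N ^ n) ^ CARD('d)) * (p ^ n * crossing_factor ^ (Suc n - i))"
  proof (rule mult_right_mono)
    show "real (card ?L) \<le> real ((N ^ n) ^ CARD('d))" by (simp only: of_nat_le_iff card_level_cubes)
    show "0 \<le> p ^ n * crossing_factor ^ (Suc n - i)" using p crossing_factor by simp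
  qed
  also have "\<dots> = mean ^ n * crossing_factor ^ (Suc n - i)"
    by (simp add: mean_def power_mult_distrib mult.commute flip: power_mult)
  finally show ?le .
qed

text \<open>By Markov's inequality the exceptional probabilities are at most a constant times
  \<open>(r / s) ^ n\<close>, hence summable, and Borel--Cantelli applies. The offset
  \<open>b\<close> skips the levels without a moment bound.\<close>

lemma AE_eventually_le_power:
  fixes f :: "nat \<Rightarrow> _ \<Rightarrow> real"
  assumes f: "\<And>n. n \<ge> b \<Longrightarrow> integrable M (f n)" "\<And>n \<omega>. 0 \<le> f n \<omega>"
    and E: "\<And>n. n \<ge> b \<Longrightarrow> expectation (f n) \<le> K * r ^ n" and r: "0 \<le> r" "r < s"
  shows "AE \<omega> in M. \<forall>\<^sub>F n in sequentially. f n \<omega> < s ^ n"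
proof -
  define A where "A n = {\<omega> \<in> space M. s ^ (n + b) \<le> f (n + b) \<omega>}" for n
  have A: "A n \<in> sets M" for n
  proof -
    have [measurable]: "f (n + b) \<in> borel_measurable M" using f(1)[of "n + b"] by auto
    show ?thesis unfolding A_def by measurable
  qed
  have prob_A: "prob (A n) \<le> K * (r / s) ^ b * (r / s) ^ n" for n
  proof -
    have "prob (A n) \<le> expectation (f (n + b)) / s ^ (n + b)"
      unfolding A_def using f r by (intro integral_Markov_inequality_measure[where A = "{}"]) auto
    also have "\<dots> \<le> K * r ^ (n + b) / s ^ (n + b)" using r by (intro divide_right_mono E) auto
    finally show ?thesis by (simp add: power_divide power_add mult_ac)
  qed
  have "summable (\<lambda>n. K * (r / s) ^ b * (r / s) ^ n)"
    using r by (intro summable_mult summable_geometric) auto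
  then have "summable (\<lambda>n. prob (A n))"
    by (rule summable_comparison_test_ev[rotated]) (use prob_A in auto)
  then have "AE \<omega> in M. \<forall>\<^sub>F n in sequentially. \<omega> \<in> space M - A n"
    using A by (intro borel_cantelli_AE1) (auto simp: emeasure_eq_measure)
  then show ?thesis
  proof eventually_elim
    case (elim \<omega>)
    then have "\<forall>\<^sub>F n in sequentially. f (n + b) \<omega> < s ^ (n + b)"
      by eventually_elim (auto simp: A_def)
    then show ?case by (simp only: eventually_sequentially_seg[of "\<lambda>n. f n \<omega> < s ^ n" b])
  qed
qed

lemma AE_card_crossing:
  assumes i: "1 \<le> i" and s: "mean * crossing_factor < s"
  shows "AE \<omega> in M. \<forall>\<^sub>F n in sequentially. real (card (crossing_cubes N \<omega> i n)) < s ^ n"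
\<comment> \<open>The \<open>i - 1\<close> coarsest levels carry no crossing factor;
  \<open>K\<close> compensates for them.\<close>
proof (rule AE_eventually_le_power[where b = i and K = "1 / crossing_factor ^ (i - 1)", OF _ _ _ _ s])
  fix n assume n: "i \<le> n"
  then have *: "1 \<le> n" "i \<le> Suc n" using i by auto
  show "integrable M (\<lambda>\<omega>. real (card (crossing_cubes N \<omega> i n)))"
    by (rule expectation_card_crossing(1)[OF *(1) i *(2)])
  have "n = (Suc n - i) + (i - 1)" using n i by simp
  then have "crossing_factor ^ n = crossing_factor ^ (Suc n - i) * crossing_factor ^ (i - 1)"
    by (metis power_add)
  then have "crossing_factor ^ (Suc n - i) = 1 / crossing_factor ^ (i - 1) * crossing_factor ^ n"
    using crossing_factor by simp
  then show "expectation (\<lambda>\<omega>. real (card (crossing_cubes N \<omega> i n))) \<le> 1 / crossing_factor ^ (i - 1) * (mean * crossing_factor) ^ n"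
    using expectation_card_crossing(2)[OF *(1) i *(2)] by (simp add: power_mult_distrib mult_ac)
qed (use mean_nonneg crossing_factor in auto)

lemma AE_card_retained:
  assumes s: "mean < s"
  shows "AE \<omega> in M. \<forall>\<^sub>F n in sequentially. real (card (retained_cubes N \<omega> n)) < s ^ n"
proof (rule AE_eventually_le_power[where b = 1 and K = 1, OF _ _ _ mean_nonneg s])
  fix n :: nat assume n: "1 \<le> n"
  have eq: "crossing_cubes N \<omega> (Suc n) n = retained_cubes N \<omega> n" for \<omega> :: "(real ^ 'd) set \<Rightarrow> bool"
    unfolding crossing_cubes_def by auto
  show "integrable M (\<lambda>\<omega>. real (card (retained_cubes N \<omega> n)))"
    "expectation (\<lambda>\<omega>. real (card (retained_cubes N \<omega> n))) \<le> 1 * mean ^ n"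
    using expectation_card_crossing[OF n, of "Suc n"] unfolding eq by auto
qed auto

section \<open>Almost sure dimension bounds\<close>

lemma exists_scale:
  assumes "0 < \<epsilon>"
  obtains i where "1 \<le> i" "real CARD('d) / real N ^ i < \<epsilon>"
proof -
  obtain i where i: "real CARD('d) / \<epsilon> < real N ^ i" using real_arch_pow[of "real N" "real CARD('d) / \<epsilon>"] N by auto
  also have "\<dots> \<le> real N ^ Suc i" using N0 by simp
  finally have "real CARD('d) / real N ^ Suc i < \<epsilon>" using assms N0 by (simp add: field_simps)
  then show thesis using that[of "Suc i"] by simp
qed

text \<open>The bound is deterministic and hence passes to the expectation. The maximum with 1
  enters because \<open>upper_box_dim_le_limit\<close> takes rates of at least 1.\<close>

lemma upper_box_dim_large_part:
  assumes \<epsilon>: "0 < \<epsilon>"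
  shows "AE \<omega> in M. upper_box_dim (large_part \<epsilon> (limit_set N \<omega>)) \<le> ereal (ln (max 1 (mean * crossing_factor)) / ln N)"
proof -
  define r where "r = max 1 (mean * crossing_factor)"
  obtain i where i: "1 \<le> i" "real CARD('d) / real N ^ i < \<epsilon>" using exists_scale[OF \<epsilon>] .
  have "AE \<omega> in M. \<forall>j. \<forall>\<^sub>F n in sequentially. real (card (crossing_cubes N \<omega> i n)) < (r + inverse (real (Suc j))) ^ n"
    unfolding AE_all_countable
  proof
    fix j
    have "mean * crossing_factor \<le> r" by (simp add: r_def)
    moreover have "0 < inverse (real (Suc j))" by simp
    ultimately show "AE \<omega> in M. \<forall>\<^sub>F n in sequentially. real (card (crossing_cubes N \<omega> i n)) < (r + inverse (real (Suc j))) ^ n"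
      by (intro AE_card_crossing i) linarith
  qed
  then show ?thesis
    unfolding r_def[symmetric]
  proof eventually_elim
    case (elim \<omega>)
    show ?case
    proof (rule upper_box_dim_le_limit[OF N])
      fix j
      show "\<forall>\<^sub>F n in sequentially. \<exists>V\<subseteq>level_cubes N n. large_part \<epsilon> (limit_set N \<omega>) \<subseteq> \<Union>V \<and>
          real (card V) \<le> (r + inverse (real (Suc j))) ^ n"
        using elim[rule_format, of j] eventually_ge_at_top[of 1]
      proof eventually_elim
        case (elim n)
        have "crossing_cubes N \<omega> i n \<subseteq> level_cubes N n"
          unfolding crossing_cubes_def retained_cubes_def by auto
        then show ?case
          using large_part_subset_crossing_cubes[OF N0 i elim(2)] elim(1) by (meson less_imp_le)
      qed
    qed (simp add: r_def)
  qed
qed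

text \<open>\<open>F\<close> is quantified inside \<open>AE\<close>, so it may depend on
  \<open>\<omega>\<close>; it will be the nontrivial part.\<close>

lemma upper_box_dim_limit_set:
  assumes mean: "1 \<le> mean"
  shows "AE \<omega> in M. \<forall>F\<subseteq>limit_set N \<omega>. upper_box_dim F \<le> ereal (ln mean / ln N)"
proof -
  have "AE \<omega> in M. \<forall>j. \<forall>\<^sub>F n in sequentially. real (card (retained_cubes N \<omega> n)) < (mean + inverse (real (Suc j))) ^ n"
    unfolding AE_all_countable by (intro allI AE_card_retained) simp
  then show ?thesis
  proof eventually_elim
    case (elim \<omega>)
    show ?case
    proof (intro allI impI upper_box_dim_le_limit[OF N mean])
      fix F j assume F: "F \<subseteq> limit_set N \<omega>"
      show "\<forall>\<^sub>F n in sequentially. \<exists>V\<subseteq>level_cubes N n. F \<subseteq> \<Union>V \<and> real (card V) \<le> (mean + inverse (real (Suc j))) ^ n"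
        using elim[rule_format, of j] eventually_ge_at_top[of 1]
      proof eventually_elim
        case (elim n)
        have "F \<subseteq> \<Union>(retained_cubes N \<omega> n)"
          using F limit_set_subset[OF elim(2), of N \<omega>] unfolding approx_set_def by simp
        then show ?case using retained_cubes_level elim(1) by (meson less_imp_le)
      qed
    qed
  qed
qed

lemma bounded_limit_set: "bounded (limit_set N \<omega>)"
  using compact_imp_bounded[OF compact_approx_set[OF N0]] limit_set_subset[of 1 N \<omega>] bounded_subset by blast

lemma limit_set_subset_unit: "limit_set N \<omega> \<subseteq> \<Union>(level_cubes N 0)"
proof
  fix x assume "x \<in> limit_set N \<omega>"
  then have "x \<in> approx_set N \<omega> 1" using limit_set_subset[of 1 N \<omega>] by auto
  then obtain Q where Q: "Q \<in> level_cubes N 1" "x \<in> Q" unfolding approx_set_def retained_cubes_def by auto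
  obtain R where "R \<in> level_cubes N 0" "Q \<subseteq> R" by (rule level_cube_ancestor[OF N0 Q(1), of 0]) auto
  then show "x \<in> \<Union>(level_cubes N 0)" using Q(2) by blast
qed

text \<open>Even at \<open>mean = 1\<close> the product with \<open>crossing_factor\<close> is below
  1, so some \<open>s < 1\<close> is available; a number of cubes below \<open>s ^ n\<close> is 0.
  Countably many thresholds then exhaust all nontrivial components.\<close>

lemma AE_trivial_if_subcritical:
  assumes mean: "mean \<le> 1"
  shows "AE \<omega> in M. nontrivial_part (limit_set N \<omega>) = {}"
proof -
  have "mean * crossing_factor \<le> 1 * crossing_factor" using mean crossing_factor by (intro mult_right_mono) auto
  then have lt: "mean * crossing_factor < 1" using crossing_factor by linarith
  obtain s where s: "mean * crossing_factor < s" "s < 1" using dense[OF lt] by blast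
  have s0: "0 \<le> s" using s mean_nonneg crossing_factor by (smt (verit) mult_nonneg_nonneg)
  have "AE \<omega> in M. large_part (inverse (real (Suc j))) (limit_set N \<omega>) = {}" for j
  proof -
    obtain i where i: "1 \<le> i" "real CARD('d) / real N ^ i < inverse (real (Suc j))"
      using exists_scale[of "inverse (real (Suc j))"] by auto
    show ?thesis
      using AE_card_crossing[OF i(1) s(1)]
    proof eventually_elim
      case (elim \<omega>)
      then obtain n where n: "1 \<le> n" "real (card (crossing_cubes N \<omega> i n)) < s ^ n"
        using eventually_happens'[OF sequentially_bot eventually_conj[OF eventually_ge_at_top[of 1] elim]] by blast
      have "s ^ n \<le> 1" using s0 s(2) by (simp add: power_le_one)
      then have "card (crossing_cubes N \<omega> i n) = 0" using n(2) by linarith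
      moreover have "finite (crossing_cubes N \<omega> i n)"
        unfolding crossing_cubes_def by (simp add: finite_retained_cubes)
      ultimately have "crossing_cubes N \<omega> i n = {}" by simp
      then show ?case using large_part_subset_crossing_cubes[OF N0 i n(1), of \<omega>] by simp
    qed
  qed
  then have "AE \<omega> in M. \<forall>j. large_part (inverse (real (Suc j))) (limit_set N \<omega>) = {}"
    unfolding AE_all_countable by blast
  then show ?thesis
    by eventually_elim (use nontrivial_part_large_part[OF bounded_limit_set] in blast)
qed

text \<open>The upper bound counts all retained cubes, the lower bound the cubes marked with some
  event \<open>A i\<close> of positive probability, each of which meets the nontrivial part.\<close>

lemma box_dim_nontrivial_part:
  assumes mean: "1 < mean" and not_AE: "\<not> (AE \<omega> in M. nontrivial_part (limit_set N \<omega>) = {})"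
  shows "AE \<omega> in M. nontrivial_part (limit_set N \<omega>) \<noteq> {} \<longrightarrow>
    box_dim (nontrivial_part (limit_set N \<omega>)) = ereal (ln mean / ln N)"
proof -
  define A where "A i \<omega> \<longleftrightarrow> (\<forall>n\<ge>1. linked N (inverse (real (Suc i))) n \<omega>)" for i and \<omega> :: "(real ^ 'd) set \<Rightarrow> bool"
  have sets_A: "{\<omega> \<in> space M. A i \<omega>} \<in> sets M" for i
  proof -
    have "{\<omega> \<in> space M. linked N (inverse (real (Suc i))) n \<omega>} \<in> sets M" if "1 \<le> n" for n
      unfolding linked_def approx_set_def
      by (rule sets_retained[OF that, of "\<lambda>X. \<exists>x y. inverse (real (Suc i)) \<le> dist x y \<and> connected_component (\<Union>X) x y"])
    then have "{\<omega> \<in> space M. \<forall>n. linked N (inverse (real (Suc i))) (Suc n) \<omega>} \<in> sets M"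
      by (intro sets.sets_Collect_countable_All) simp
    moreover have "A i \<omega> \<longleftrightarrow> (\<forall>n. linked N (inverse (real (Suc i))) (Suc n) \<omega>)" for \<omega>
      unfolding A_def by (auto dest: Suc_le_D)
    ultimately show ?thesis by simp
  qed
  \<comment> \<open>A nontrivial component puts the configuration into some \<open>A i\<close>, so
    if all these events were null the nontrivial part would almost surely be empty.\<close>
  have "\<exists>i. 0 < prob {\<omega> \<in> space M. A i \<omega>}"
  proof (rule ccontr)
    assume "\<not> (\<exists>i. 0 < prob {\<omega> \<in> space M. A i \<omega>})"
    then have "prob {\<omega> \<in> space M. A i \<omega>} = 0" for i
      using measure_nonneg[of M "{\<omega> \<in> space M. A i \<omega>}"] by (meson not_less order_antisym)
    then have "AE \<omega> in M. \<not> A i \<omega>" for i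
      using sets_A by (subst AE_iff_measurable[OF _ refl]) (auto simp: emeasure_eq_measure)
    then have "AE \<omega> in M. \<forall>i. \<not> A i \<omega>" unfolding AE_all_countable by blast
    then have "AE \<omega> in M. nontrivial_part (limit_set N \<omega>) = {}"
      by eventually_elim (use linked_if_nontrivial in \<open>unfold A_def, blast\<close>)
    then show False using not_AE by simp
  qed
  then obtain i where i: "0 < prob {\<omega> \<in> space M. A i \<omega>}" by blast
  have A_nontrivial: "nontrivial_part (limit_set N \<omega>) \<noteq> {}" if "A i \<omega>" for \<omega>
    using that unfolding A_def by (intro nontrivial_if_linked[OF N0, of "inverse (real (Suc i))"]) auto
  have growth: "AE \<omega> in M. extinct \<omega> \<or> fast_growth (A i) \<omega>"
    by (rule AE_extinct_or_fast_growth[OF sets_A mean i]) (rule A_nontrivial)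
  show ?thesis
    using growth upper_box_dim_limit_set[OF less_imp_le[OF mean]]
  proof eventually_elim
    case (elim \<omega>)
    let ?F = "nontrivial_part (limit_set N \<omega>)"
    have F: "?F \<subseteq> limit_set N \<omega>" unfolding nontrivial_part_def by auto
    show ?case
    proof (intro impI box_dim_eqI)
      assume ne: "?F \<noteq> {}"
      show "upper_box_dim ?F \<le> ereal (ln mean / ln N)" using elim(2) F by blast
      have "fast_growth (A i) \<omega>" using elim(1) ne F limit_set_extinct[of \<omega>] by blast
      then obtain j where j: "\<forall>\<^sub>F n in sequentially. mean ^ n \<le> real (Suc j) * marked_count (A i) n \<omega>"
        unfolding fast_growth_def by blast
      show "ereal (ln mean / ln N) \<le> lower_box_dim ?F"
      proof (rule lower_box_dim_ge[OF N mean _ ne])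
        show "0 < inverse (real (Suc j))" by simp
        show "?F \<subseteq> \<Union>(level_cubes N 0)" using F limit_set_subset_unit by blast
        show "\<forall>\<^sub>F n in sequentially. \<exists>V\<subseteq>level_cubes N n. (\<forall>Q\<in>V. Q \<inter> ?F \<noteq> {}) \<and> inverse (real (Suc j)) * mean ^ n \<le> real (card V)"
          using j
        proof eventually_elim
          case (elim n)
          have "inverse (real (Suc j)) * mean ^ n \<le> marked_count (A i) n \<omega>"
            using elim by (simp add: field_simps)
          then show ?case
            using marked_level[OF N0] marked_meets_nontrivial[OF N A_nontrivial]
            by (intro exI[of _ "marked N (A i) n \<omega>"]) blast
        qed
      qed
    qed
  qed
qed

text \<open>Either the nontrivial part is almost surely empty and the claim is vacuous, or
  \<open>1 < mean\<close>. Then the expectation is at most \<open>ln r / ln N\<close>, and the box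
  dimension is almost surely \<open>ln mean / ln N\<close> when the nontrivial part is
  nonempty.\<close>

theorem expected_dimension_gap:
  "\<exists>D<1. \<forall>\<epsilon>>0. AE \<omega> in M. nontrivial_part (limit_set N \<omega>) \<noteq> {} \<longrightarrow>
     expect_nonneg M (\<lambda>\<omega>'. lower_box_dim (large_part \<epsilon> (limit_set N \<omega>')))
       \<le> ereal D * box_dim (nontrivial_part (limit_set N \<omega>))"
proof (cases "AE \<omega> in M. nontrivial_part (limit_set N \<omega>) = {}")
  case True
  then have "AE \<omega> in M. nontrivial_part (limit_set N \<omega>) \<noteq> {} \<longrightarrow> P \<omega>" for P by eventually_elim simp
  then show ?thesis by (intro exI[of _ 0] conjI allI impI) simp_all
next
  case False
  then have mean: "1 < mean" using AE_trivial_if_subcritical by force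
  define r where "r = max 1 (mean * crossing_factor)"
  \<comment> \<open>The quotient of the two dimensions. \<open>\<epsilon>\<close> affects only the
    level at which the crossing condition begins, not the rate \<open>r\<close>.\<close>
  define D where "D = ln r / ln mean"
  have r: "1 \<le> r" "r < mean"
    using mean crossing_factor by (auto simp: r_def)
  have lnm: "0 < ln mean" and lnN: "0 < ln (real N)" using mean N by auto
  have "D < 1" unfolding D_def using lnm r by simp
  moreover have "AE \<omega> in M. nontrivial_part (limit_set N \<omega>) \<noteq> {} \<longrightarrow>
     expect_nonneg M (\<lambda>\<omega>'. lower_box_dim (large_part \<epsilon> (limit_set N \<omega>')))
       \<le> ereal D * box_dim (nontrivial_part (limit_set N \<omega>))" if \<epsilon>: "0 < \<epsilon>" for \<epsilon>
  proof -
    have nonneg: "0 \<le> ln r / ln N" using r lnN by simp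
    have "(\<integral>\<^sup>+ \<omega>. e2ennreal (lower_box_dim (large_part \<epsilon> (limit_set N \<omega>))) \<partial>M) \<le> (\<integral>\<^sup>+ \<omega>. ennreal (ln r / ln N) \<partial>M)"
    proof (rule nn_integral_mono_AE)
      show "AE \<omega> in M. e2ennreal (lower_box_dim (large_part \<epsilon> (limit_set N \<omega>))) \<le> ennreal (ln r / ln N)"
        using upper_box_dim_large_part[OF \<epsilon>]
      proof eventually_elim
        case (elim \<omega>)
        then have "lower_box_dim (large_part \<epsilon> (limit_set N \<omega>)) \<le> ereal (ln r / ln N)"
          using lower_le_upper_box_dim order_trans unfolding r_def by blast
        then have "e2ennreal (lower_box_dim (large_part \<epsilon> (limit_set N \<omega>))) \<le> e2ennreal (ereal (ln r / ln N))"
          by (rule e2ennreal_mono)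
        then show ?case by (simp add: e2ennreal_ereal)
      qed
    qed
    also have "\<dots> = ennreal (ln r / ln N)" by (simp add: emeasure_space_1)
    finally have "expect_nonneg M (\<lambda>\<omega>'. lower_box_dim (large_part \<epsilon> (limit_set N \<omega>'))) \<le> enn2ereal (ennreal (ln r / ln N))"
      unfolding expect_nonneg_def by (simp add: less_eq_ennreal.rep_eq)
    also have "\<dots> = ereal (ln r / ln N)" using nonneg by (simp add: enn2ereal_ennreal)
    also have "\<dots> = ereal D * ereal (ln mean / ln N)" using lnm by (simp add: D_def)
    finally have le: "expect_nonneg M (\<lambda>\<omega>'. lower_box_dim (large_part \<epsilon> (limit_set N \<omega>'))) \<le> ereal D * ereal (ln mean / ln N)" .
    show ?thesis
      using box_dim_nontrivial_part[OF mean False] by eventually_elim (use le in simp)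
  qed
  ultimately show ?thesis by blast
qed

end

theorem proposition1p3:
  fixes N :: nat and p :: real
  assumes "CARD('d::finite) \<ge> 2"
    and "N \<ge> 2"
    and "critical_prob TYPE('d) N \<le> p"
    and "p < 1"
  shows "\<exists>D<1. \<forall>\<epsilon>>0.
    AE \<omega> in (percolation N p :: ((real ^ 'd) set \<Rightarrow> bool) measure).
      nontrivial_part (limit_set N \<omega>) \<noteq> {} \<longrightarrow>
        expect_nonneg (percolation N p :: ((real ^ 'd) set \<Rightarrow> bool) measure)
            (\<lambda>\<omega>'. lower_box_dim (large_part \<epsilon> (limit_set N \<omega>')))
          \<le> ereal D * box_dim (nontrivial_part (limit_set N \<omega>))"
proof -
  \<comment> \<open>\<open>bernoulli_pmf\<close> clamps its argument, so a negative \<open>p\<close>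
    gives the measure of parameter 0 and the locale can be interpreted with
    \<open>max 0 p\<close>.\<close>
  have "bernoulli_pmf (max 0 p) = bernoulli_pmf p"
    by (rule pmf_eqI) (simp add: bernoulli_pmf.rep_eq)
  then have "percolation N p = (percolation N (max 0 p) :: ((real ^ 'd) set \<Rightarrow> bool) measure)"
    unfolding percolation_def by simp
  then interpret fractal_percolation N "max 0 p" "percolation N p :: ((real ^ 'd) set \<Rightarrow> bool) measure"
    using assms by unfold_locales auto
  show ?thesis by (rule expected_dimension_gap)
qed

end
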